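(* Let $L$ be a solvable Leibniz algebra over a field $F$. If $\operatorname{char}F=p\neq 0$, suppose further that $L^2$ is of nilpotency class less than $p$. Then the Cartan subalgebras of $L$ are conjugate under $I(L,L^2)$; that is, for any two Cartan subalgebras $H_1,H_2$ of $L$ there is $\beta\in I(L,L^2)$ with $\beta(H_1)=H_2$.
   Context: Leibniz algebras are finite-dimensional left Leibniz algebras over a field: the product satisfies $x(yz)=(xy)z+y(xz)$, i.e. every left multiplication $L_x: y\mapsto xy$ is a derivation. $L^2$ is the span of all products $xy$ with $x,y\in L$. For $x\in L^2$, $\exp(L_x)=\sum_{r\ge 0}\frac{1}{r!}L_x^r$, which under the stated hypotheses is a finite sum ($L_x$ is nilpotent, with $L_x^p=0$ in characteristic $p$) and an automorphism of $L$. $I(L,L^2)$ is the subgroup of the automorphism group of $L$ generated by all $\exp(L_x)$, $x\in L^2$. A Cartan subalgebra of $L$ is a nilpotent subalgebra $C$ with $C=\mathcal{N}_L(C)$, where $\mathcal{N}_L(C)=\{x\in L: xC\subseteq C \text{ and } Cx\subseteq C\}$ is the normalizer of $C$ in $L$. *)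

theory Defs
  imports Complex_Main "HOL-Library.Groups_Big_Fun" "HOL-Algebra.Generated_Groups"
begin

text \<open>
  A finite-dimensional left Leibniz algebra. The algebra is the whole type
  \<^typ>\<open>'v\<close>; its scalar multiplication and its product are explicit parameters.
\<close>

locale leibniz_algebra = vector_space scale
  for scale :: "'f::field \<Rightarrow> 'v::ab_group_add \<Rightarrow> 'v" +
  fixes mul :: "'v \<Rightarrow> 'v \<Rightarrow> 'v"
  assumes finite_dim: "\<exists>B. finite B \<and> span B = UNIV"
    and linear_left_mult: "Vector_Spaces.linear scale scale (\<lambda>y. mul x y)"
    and linear_right_mult: "Vector_Spaces.linear scale scale (\<lambda>x. mul x y)"
    and leibniz: "mul x (mul y z) = mul (mul x y) z + mul y (mul x z)"
begin

definition prod_space :: "'v set \<Rightarrow> 'v set \<Rightarrow> 'v set" where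
  "prod_space A B = span {mul a b | a b. a \<in> A \<and> b \<in> B}"

definition square :: "'v set" where
  "square = prod_space UNIV UNIV"

definition subalgebra :: "'v set \<Rightarrow> bool" where
  "subalgebra A \<longleftrightarrow> subspace A \<and> (\<forall>a\<in>A. \<forall>b\<in>A. mul a b \<in> A)"

primrec derived_series :: "nat \<Rightarrow> 'v set" where
  "derived_series 0 = UNIV"
| "derived_series (Suc n) = prod_space (derived_series n) (derived_series n)"

definition solvable :: bool where
  "solvable \<longleftrightarrow> (\<exists>n. derived_series n = {0})"

text \<open>
  Indexing starts at \<open>0\<close>, so that \<open>lower_central A n\<close> is spanned by the products
  of \<open>n + 1\<close> factors from \<open>A\<close>. In a left Leibniz algebra the right-normed products
  span all products of a given length, so multiplying from the left suffices.
  With this indexing an algebra of nilpotency class \<open>c\<close> is one for which \<open>c\<close> is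
  the least index where the series vanishes: \<open>0\<close> for the zero algebra, at most \<open>1\<close>
  for an algebra with zero product.
\<close>

primrec lower_central :: "'v set \<Rightarrow> nat \<Rightarrow> 'v set" where
  "lower_central A 0 = A"
| "lower_central A (Suc n) = prod_space A (lower_central A n)"

definition nilpotent :: "'v set \<Rightarrow> bool" where
  "nilpotent A \<longleftrightarrow> (\<exists>n. lower_central A n = {0})"

text \<open>Only meaningful when \<open>nilpotent A\<close> holds.\<close>

definition nilpotency_class :: "'v set \<Rightarrow> nat" where
  "nilpotency_class A = (LEAST n. lower_central A n = {0})"

definition normalizer :: "'v set \<Rightarrow> 'v set" where
  "normalizer C = {x. \<forall>c\<in>C. mul x c \<in> C \<and> mul c x \<in> C}"

definition cartan_subalgebra :: "'v set \<Rightarrow> bool" where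
  "cartan_subalgebra C \<longleftrightarrow> subalgebra C \<and> nilpotent C \<and> C = normalizer C"

definition automorphism :: "('v \<Rightarrow> 'v) \<Rightarrow> bool" where
  "automorphism f \<longleftrightarrow>
     Vector_Spaces.linear scale scale f \<and> bij f \<and> (\<forall>x y. f (mul x y) = mul (f x) (f y))"

definition aut_group :: "('v \<Rightarrow> 'v) monoid" where
  "aut_group = \<lparr>carrier = Collect automorphism, mult = (\<circ>), one = id\<rparr>"

text \<open>
  \<open>Sum_any\<close> sums the nonzero terms, provided there are only finitely many. If left
  multiplication by \<open>x\<close> is nilpotent and, in characteristic \<open>p > 0\<close>, its \<open>p\<close>-th
  power vanishes, then this is the exponential series. (In characteristic \<open>p\<close> the
  coefficients for \<open>r \<ge> p\<close> are \<open>inverse 0 = 0\<close>, matching the vanishing of the powers.)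
\<close>

definition exp_left :: "'v \<Rightarrow> 'v \<Rightarrow> 'v" where
  "exp_left x y = Sum_any (\<lambda>r::nat. scale (inverse (of_nat (fact r))) ((mul x ^^ r) y))"

text \<open>
  \<open>inner_group A\<close> is the group written \<open>I(L, A)\<close>. It is a subgroup of \<open>aut_group\<close>
  when all \<open>exp_left x\<close> with \<open>x \<in> A\<close> are automorphisms.
\<close>

definition inner_group :: "'v set \<Rightarrow> ('v \<Rightarrow> 'v) set" where
  "inner_group A = generate aut_group (exp_left ` A)"

end

end

theory Submission
  imports Defs "HOL-Computational_Algebra.Polynomial" "HOL-Computational_Algebra.Primes"
begin

text \<open>
  Suppose \<open>H + A = K + A = U\<close> for two Cartan subalgebras \<open>H\<close>, \<open>K\<close> and an ideal \<open>A\<close> of \<open>U\<close>; initially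
  \<open>A = U = L\<close>. Let \<open>A / B\<close> be a chief factor of \<open>U\<close>. It suffices to move \<open>H\<close> by an element of
  \<open>I(L, L\<^sup>2)\<close> so that \<open>H + B = K + B\<close>, because \<open>A\<close> can then be replaced by \<open>B\<close>. If \<open>H\<close> acts
  trivially on \<open>A / B\<close>, then \<open>A\<close> lies in \<open>H + B\<close> and in \<open>K + B\<close>, since subspaces above a Cartan
  subalgebra contain their normalizer. Otherwise some \<open>z \<in> H\<close> acts bijectively on \<open>A / B\<close>. An
  exponential \<open>exp(L\<^sub>x)\<close> with \<open>x \<in> A \<inter> L\<^sup>2\<close> moves \<open>z\<close> into \<open>K + B\<close>; as \<open>z\<close> acts nilpotently on both
  subalgebras and injectively on \<open>A / B\<close>, they then agree modulo \<open>B\<close>. In characteristic \<open>0\<close> the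
  maps \<open>L\<^sub>x\<close> are nilpotent because \<open>L\<^sup>2\<close> acts trivially on the composition factors of \<open>L\<close>, by
  Jacobson's lemma on commutators.
\<close>

context leibniz_algebra
begin

subsection \<open>Subspaces and central series\<close>

lemma mul_add_left: "mul (a + b) c = mul a c + mul b c"
  and mul_add_right: "mul c (a + b) = mul c a + mul c b"
  and mul_scale_left: "mul (scale r a) c = scale r (mul a c)"
  and mul_scale_right: "mul c (scale r a) = scale r (mul c a)"
proof -
  interpret l: Vector_Spaces.linear scale scale "\<lambda>y. mul c y" by (rule linear_left_mult)
  interpret r: Vector_Spaces.linear scale scale "\<lambda>x. mul x c" by (rule linear_right_mult)
  show "mul (a + b) c = mul a c + mul b c" "mul c (a + b) = mul c a + mul c b"
    "mul (scale r a) c = scale r (mul a c)" "mul c (scale r a) = scale r (mul c a)"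
    by (rule r.add l.add r.scale l.scale)+
qed

lemma mul_zero_left [simp]: "mul 0 c = 0"
  using mul_add_left [of 0 0 c] by simp

lemma mul_zero_right [simp]: "mul c 0 = 0"
  using mul_add_right [of c 0 0] by simp

lemma mul_diff_left: "mul (a - b) c = mul a c - mul b c"
  using mul_add_left [of "a - b" b c] by simp

lemma mul_diff_right: "mul c (a - b) = mul c a - mul c b"
  using mul_add_right [of c "a - b" b] by simp

lemmas mul_distribs = mul_add_left mul_add_right mul_diff_left mul_diff_right

lemma mul_sum_left: "mul (sum f I) c = (\<Sum>i\<in>I. mul (f i) c)"
  by (induction I rule: infinite_finite_induct) (simp_all add: mul_add_left)

lemma mul_sum_right: "mul c (sum f I) = (\<Sum>i\<in>I. mul c (f i))"
  by (induction I rule: infinite_finite_induct) (simp_all add: mul_add_right)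

lemma leibniz': "mul (mul x y) z = mul x (mul y z) - mul y (mul x z)"
  by (simp add: leibniz [of x y z])

text \<open>Left multiplication by \<open>mul x y\<close> is the commutator of the left
  multiplications by \<open>x\<close> and \<open>y\<close>, hence antisymmetric in \<open>x\<close>
  and \<open>y\<close>.\<close>

lemma mul_anticomm_zero: "mul (mul x y + mul y x) z = 0"
  by (simp add: mul_add_left leibniz')

lemma subspace_mul_vimage: "subspace S \<Longrightarrow> subspace {v. mul x v \<in> S}"
  by (auto simp: subspace_def mul_add_right mul_scale_right)

lemma subspace_vimage_all:
  assumes "subspace S"
  shows "subspace {v. \<forall>x\<in>X. mul x v \<in> S}" "subspace {v. \<forall>x\<in>X. mul v x \<in> S}"
  using assms by (auto simp: subspace_def mul_add_right mul_scale_right mul_add_left mul_scale_left)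

lemma subspace_coset_sum:
  assumes "subspace H" "subspace B"
  shows "subspace {u. \<exists>h\<in>H. u - h \<in> B}"
proof -
  have "{u. \<exists>h\<in>H. u - h \<in> B} = {h + b | h b. h \<in> H \<and> b \<in> B}"
    by force
  with subspace_sums [OF assms] show ?thesis by simp
qed

lemma subspace_diff_trans:
  assumes "subspace S" "x - y \<in> S" "y - z \<in> S" shows "x - z \<in> S"
  using subspace_add [OF assms] by simp

lemma subspace_diff_sym:
  assumes "subspace S" "x - y \<in> S" shows "y - x \<in> S"
  using subspace_neg [OF assms] by simp

lemma mem_of_diff_mem:
  assumes "subspace S" "x - y \<in> S" "y \<in> S" shows "x \<in> S"
  using subspace_add [OF assms] by simp

section \<open>Dimension arguments and extremal subspaces\<close>

lemma dim_subspace_less: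
  assumes "subspace A" "subspace B" "A \<subset> B"
  shows "dim A < dim B"
proof -
  obtain S where S: "finite S" "span S = UNIV" using finite_dim by blast
  obtain Bs where Bs: "Bs \<subseteq> S" "independent Bs" "S \<subseteq> span Bs"
    using maximal_independent_subset by blast
  have "span Bs = UNIV"
    using S(2) span_minimal [OF Bs(3)] by auto
  \<comment> \<open>A maximal independent subset of the finite spanning set is a basis, which gives
    access to the theory of spaces with a finite basis.\<close>
  then interpret fd: finite_dimensional_vector_space scale Bs
    using Bs S(1) by unfold_locales (auto intro: finite_subset)
  show ?thesis
    using fd.dim_psubset assms by (metis span_eq_iff)
qed

lemma dim_bounded: "subspace A \<Longrightarrow> dim A \<le> dim UNIV"
  by (metis dim_subspace_less less_imp_le order_refl psubsetI subset_UNIV subspace_UNIV)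

lemma linear_inj_surj:
  assumes "Vector_Spaces.linear scale scale f" "inj f"
  shows "surj f"
proof -
  obtain S where S: "finite S" "span S = UNIV" using finite_dim by blast
  obtain Bs where Bs: "Bs \<subseteq> S" "independent Bs" "S \<subseteq> span Bs"
    using maximal_independent_subset by blast
  have "span Bs = UNIV"
    using S(2) span_minimal [OF Bs(3)] by auto
  then interpret fd: finite_dimensional_vector_space scale Bs
    using Bs S(1) by unfold_locales (auto intro: finite_subset)
  show ?thesis
    using fd.linear_inj_imp_surj assms by blast
qed

text \<open>A subspace of greatest dimension works, dimensions being bounded by that of the whole
  space. This supplies the composition and chief factors used below.\<close>

lemma obtain_maximal_subspace:
  assumes "P M" and sub: "\<And>N. P N \<Longrightarrow> subspace N"
  obtains N where "P N" "\<And>K. P K \<Longrightarrow> N \<subseteq> K \<Longrightarrow> K = N"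
proof -
  define N where "N = arg_max dim P"
  have "P N" and max: "P K \<Longrightarrow> dim K \<le> dim N" for K
    using arg_max_nat_lemma [of P M dim "Suc (dim UNIV)"] \<open>P M\<close> sub dim_bounded
    unfolding N_def by (auto simp: less_Suc_eq_le)
  moreover have "K = N" if "P K" "N \<subseteq> K" for K
    using dim_subspace_less [of N K] max [OF \<open>P K\<close>] sub \<open>P N\<close> that by force
  ultimately show thesis using that by blast
qed

lemma obtain_minimal_subspace:
  assumes "P M" and sub: "\<And>N. P N \<Longrightarrow> subspace N"
  obtains N where "P N" "\<And>K. P K \<Longrightarrow> K \<subseteq> N \<Longrightarrow> K = N"
proof -
  define N where "N = arg_min dim P"
  have "P N" and min: "P K \<Longrightarrow> dim N \<le> dim K" for K
    using arg_min_nat_lemma [of P M dim] \<open>P M\<close> unfolding N_def by auto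
  moreover have "K = N" if "P K" "K \<subseteq> N" for K
    using dim_subspace_less [of K N] min [OF \<open>P K\<close>] sub \<open>P N\<close> that by force
  ultimately show thesis using that by blast
qed

section \<open>Product spaces, lower central series and derived series\<close>

lemma mul_mem_prod_space: "a \<in> A \<Longrightarrow> b \<in> B \<Longrightarrow> mul a b \<in> prod_space A B"
  unfolding prod_space_def by (rule span_base) blast

lemma prod_space_subset:
  assumes "subspace S" "\<And>a b. a \<in> A \<Longrightarrow> b \<in> B \<Longrightarrow> mul a b \<in> S"
  shows "prod_space A B \<subseteq> S"
  unfolding prod_space_def using assms by (intro span_minimal) auto

lemma subspace_prod_space: "subspace (prod_space A B)"
  unfolding prod_space_def by simp

lemma subspace_lower_central: "subspace A \<Longrightarrow> subspace (lower_central A n)"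
  by (cases n) (simp_all add: subspace_prod_space)

lemma subspace_derived_series: "subspace (derived_series n)"
  by (cases n) (simp_all add: subspace_prod_space)

lemma subspace_square: "subspace square"
  by (simp add: square_def subspace_prod_space)

lemma mul_mem_square: "mul x y \<in> square"
  by (simp add: square_def mul_mem_prod_space)

lemma lower_central_subset:
  assumes "subalgebra A" shows "lower_central A n \<subseteq> A"
proof (induction n)
  case (Suc n)
  then show ?case
    unfolding lower_central.simps using assms
    by (intro prod_space_subset) (auto simp: subalgebra_def)
qed simp

lemma lower_central_vanishes:
  assumes "lower_central A n = {0}" "n \<le> m"
  shows "lower_central A m = {0}"
  using assms(2)
proof (induction m rule: dec_induct)
  case base
  show ?case by (rule assms(1))
next
  case (step m)
  have "prod_space A {0} \<subseteq> {0}" by (rule prod_space_subset) auto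
  moreover have "0 \<in> prod_space A {0}" using subspace_prod_space by (rule subspace_0)
  ultimately show ?case using step by auto
qed

lemma funpow_mul_mem_lower_central:
  "x \<in> A \<Longrightarrow> y \<in> lower_central A k \<Longrightarrow> (mul x ^^ n) y \<in> lower_central A (k + n)"
  by (induction n) (simp_all add: mul_mem_prod_space)

lemma nilpotent_funpow_zero:
  assumes "nilpotent A"
  shows "\<exists>n. \<forall>m\<ge>n. \<forall>x\<in>A. \<forall>y\<in>A. (mul x ^^ m) y = 0"
proof -
  obtain n where n: "lower_central A n = {0}" using assms by (auto simp: nilpotent_def)
  have "(mul x ^^ m) y = 0" if "n \<le> m" "x \<in> A" "y \<in> A" for m x y
    using funpow_mul_mem_lower_central [of x A y 0 m] lower_central_vanishes [OF n that(1)] that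
    by simp
  then show ?thesis by blast
qed

text \<open>The series is built from right-normed products;
  \<open>(a c) y = a (c y) - c (a y)\<close> brings a product of two such elements back to that
  form. Indices \<open>i\<close> and \<open>j\<close> stand for \<open>i + 1\<close> and
  \<open>j + 1\<close> factors, whence the additional 1.\<close>

lemma mul_lower_central:
  assumes A: "subalgebra A"
  shows "x \<in> lower_central A i \<Longrightarrow> y \<in> lower_central A j \<Longrightarrow>
    mul x y \<in> lower_central A (i + j + 1)"
proof (induction i arbitrary: j x y)
  case 0
  then show ?case by (simp add: mul_mem_prod_space)
next
  case (Suc i)
  have sub: "subspace (lower_central A n)" for n
    using A by (simp add: subalgebra_def subspace_lower_central)
  have "lower_central A (Suc i)
      \<subseteq> {v. \<forall>y\<in>lower_central A j. mul v y \<in> lower_central A (Suc i + j + 1)}"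
    unfolding lower_central.simps(2)
  proof (rule prod_space_subset)
    fix a c assume a: "a \<in> A" and c: "c \<in> lower_central A i"
    show "mul a c \<in> {v. \<forall>y\<in>lower_central A j. mul v y \<in> lower_central A (Suc i + j + 1)}"
    proof (intro CollectI ballI)
      fix y assume y: "y \<in> lower_central A j"
      have "mul a (mul c y) \<in> lower_central A (Suc (i + j + 1))"
        using Suc.IH [OF c y] a by (simp add: mul_mem_prod_space)
      moreover have "mul c (mul a y) \<in> lower_central A (i + Suc j + 1)"
        using Suc.IH [OF c, of "mul a y" "Suc j"] a y by (simp add: mul_mem_prod_space)
      ultimately show "mul (mul a c) y \<in> lower_central A (Suc i + j + 1)"
        unfolding leibniz' using subspace_diff [OF sub [of "Suc (Suc (i + j))"]] by simp
    qed
  qed (rule subspace_vimage_all [OF sub])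
  with Suc.prems show ?case by blast
qed

subsection \<open>Exponentials of left multiplications\<close>

lemma funpow_add_mul: "(mul x ^^ n) (u + v) = (mul x ^^ n) u + (mul x ^^ n) v"
  by (induction n) (simp_all add: mul_add_right)

lemma funpow_diff_mul: "(mul x ^^ n) (u - v) = (mul x ^^ n) u - (mul x ^^ n) v"
  by (induction n) (simp_all add: mul_diff_right)

lemma funpow_scale_mul: "(mul x ^^ n) (scale r u) = scale r ((mul x ^^ n) u)"
  by (induction n) (simp_all add: mul_scale_right)

lemma funpow_zero_mul [simp]: "(mul x ^^ n) 0 = 0"
  by (induction n) simp_all

lemma funpow_mem:
  assumes "\<And>v. v \<in> S \<Longrightarrow> mul x v \<in> S" "v \<in> S"
  shows "(mul x ^^ n) v \<in> S"
  using assms by (induction n) simp_all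

lemma funpow_sum_mul: "(mul x ^^ n) (sum f I) = (\<Sum>i\<in>I. (mul x ^^ n) (f i))"
  by (induction I rule: infinite_finite_induct) (simp_all add: funpow_add_mul)

text \<open>The general Leibniz rule for powers of a derivation.\<close>

lemma funpow_mul_leibniz:
  "(mul x ^^ n) (mul u v) =
    (\<Sum>i\<le>n. scale (of_nat (n choose i)) (mul ((mul x ^^ i) u) ((mul x ^^ (n - i)) v)))"
proof (induction n)
  case (Suc n)
  define t where "t i j = mul ((mul x ^^ i) u) ((mul x ^^ j) v)" for i j
  have t: "mul x (t i j) = t (Suc i) j + t i (Suc j)" for i j
    unfolding t_def by (subst leibniz) simp
  have "(mul x ^^ Suc n) (mul u v) =
      (\<Sum>i\<le>n. scale (of_nat (n choose i)) (t (Suc i) (n - i) + t i (Suc (n - i))))"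
    by (simp add: Suc.IH mul_sum_right mul_scale_right t t_def [symmetric])
  also have "\<dots> = (\<Sum>i\<le>n. scale (of_nat (n choose i)) (t (Suc i) (n - i)))
      + (\<Sum>i\<le>n. scale (of_nat (n choose i)) (t i (Suc n - i)))"
    by (simp add: scale_right_distrib sum.distrib Suc_diff_le)
  \<comment> \<open>The added term has coefficient \<open>n choose Suc n = 0\<close>; splitting off
    the term at 0 then aligns both sums for Pascal's rule.\<close>
  also have "(\<Sum>i\<le>n. scale (of_nat (n choose i)) (t i (Suc n - i)))
      = (\<Sum>i\<le>Suc n. scale (of_nat (n choose i)) (t i (Suc n - i)))"
    by (simp add: binomial_eq_0)
  also have "\<dots> = t 0 (Suc n) + (\<Sum>i\<le>n. scale (of_nat (n choose Suc i)) (t (Suc i) (n - i)))"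
    by (subst sum.atMost_Suc_shift) simp
  finally have "(mul x ^^ Suc n) (mul u v) = t 0 (Suc n) +
      (\<Sum>i\<le>n. scale (of_nat (Suc n choose Suc i)) (t (Suc i) (n - i)))"
    by (simp add: sum.distrib scale_left_distrib)
  also have "\<dots> = (\<Sum>i\<le>Suc n. scale (of_nat (Suc n choose i)) (t i (Suc n - i)))"
    by (subst sum.atMost_Suc_shift) simp
  finally show ?case by (simp add: t_def)
qed simp

lemma exp_left_finite:
  assumes "\<And>v. (mul x ^^ N) v = 0"
  shows "exp_left x v = (\<Sum>r<N. scale (inverse (of_nat (fact r))) ((mul x ^^ r) v))"
proof -
  have "(mul x ^^ r) v = 0" if "\<not> r < N" for r
    using assms [of "(mul x ^^ (r - N)) v"] that
    by (metis comp_apply funpow_add le_add_diff_inverse not_less)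
  then show ?thesis
    unfolding exp_left_def by (intro Sum_any.expand_superset) (auto simp: scale_eq_0_iff)
qed

text \<open>The coefficient identity is demanded only after scaling the products: in characteristic
  \<open>p\<close> the two coefficients may differ when \<open>i + j \<ge> p\<close>, and then the
  product itself has to vanish. Bijectivity follows from injectivity in finite dimension, and
  multiplicativity is the Cauchy product of two exponential series.\<close>

lemma automorphism_exp_left:
  assumes nil: "\<And>v. (mul x ^^ N) v = 0"
    and coeff: "\<And>i j u v. scale (inverse (of_nat (fact (i + j))) * of_nat (i + j choose i))
        (mul ((mul x ^^ i) u) ((mul x ^^ j) v)) =
      scale (inverse (of_nat (fact i)) * inverse (of_nat (fact j)))
        (mul ((mul x ^^ i) u) ((mul x ^^ j) v))"
  shows "automorphism (exp_left x)"
proof -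
  let ?c = "\<lambda>r. inverse (of_nat (fact r)) :: 'f" and ?D = "\<lambda>r. mul x ^^ r"
  have nil': "?D r v = 0" if "N \<le> r" for r v
    using nil [of "?D (r - N) v"] that by (metis comp_apply funpow_add le_add_diff_inverse)
  have lin: "Vector_Spaces.linear scale scale (exp_left x)"
    unfolding Vector_Spaces.linear_iff exp_left_finite [OF nil]
    by (auto simp: funpow_add_mul funpow_scale_mul scale_right_distrib sum.distrib
        scale_sum_right mult.commute vector_space_axioms intro!: sum.cong)
  have ker: "v = 0" if exp0: "exp_left x v = 0" for v
  proof (rule ccontr)
    assume v: "v \<noteq> 0"
    define k where "k = (LEAST k. ?D k v = 0)"
    have k: "?D k v = 0" using LeastI [of "\<lambda>k. ?D k v = 0" N] nil by (simp add: k_def)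
    then have "k \<noteq> 0" using v by (cases k) auto
    then obtain l where l: "k = Suc l" by (cases k) auto
    have l0: "?D l v \<noteq> 0" using not_less_Least [of l "\<lambda>k. ?D k v = 0"] l by (simp add: k_def)
    then have "N \<noteq> 0" using nil' [of l v] by (cases N) auto
    have comm: "?D i (?D j w) = ?D j (?D i w)" for i j w
      by (metis add.commute comp_apply funpow_add)
    \<comment> \<open>Since \<open>?D l v\<close> is the last nonzero iterate, applying
      \<open>?D l\<close> to the series leaves only the term \<open>r = 0\<close>.\<close>
    have "0 = ?D l (exp_left x v)" by (simp add: exp0)
    also have "\<dots> = (\<Sum>r<N. scale (?c r) (?D r (?D l v)))"
      by (simp add: exp_left_finite [OF nil] funpow_sum_mul funpow_scale_mul comm [of l])
    also have "\<dots> = (\<Sum>r<N. if r = 0 then ?D l v else 0)"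
    proof (intro sum.cong refl)
      fix r
      have "?D r (?D l v) = 0" if "r = Suc q" for q
        using k l that by (simp add: funpow_swap1)
      then show "scale (?c r) (?D r (?D l v)) = (if r = 0 then ?D l v else 0)"
        by (cases r) auto
    qed
    also have "\<dots> = ?D l v" using \<open>N \<noteq> 0\<close> by simp
    finally show False using l0 by simp
  qed
  have "inj (exp_left x)"
  proof (rule injI)
    fix u v assume "exp_left x u = exp_left x v"
    then have "exp_left x (u - v) = 0"
      using module_hom.diff [OF Vector_Spaces.linear.axioms(3) [OF lin]] by simp
    then show "u = v" using ker by force
  qed
  then have "bij (exp_left x)" using linear_inj_surj lin by (simp add: bij_def)
  moreover have "exp_left x (mul u v) = mul (exp_left x u) (exp_left x v)" for u v
  proof -
    define g where "g i j = scale (?c i * ?c j) (mul (?D i u) (?D j v))" for i j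
    have g0: "g i j = 0" if "N \<le> i \<or> N \<le> j" for i j
      using that by (auto simp: g_def nil')
    then have g1: "i < N \<and> j < N" if "g i j \<noteq> 0" for i j
      using that not_less by blast
    \<comment> \<open>With \<open>2 * N\<close> terms the triangle \<open>i + j < 2 * N\<close>
      contains the square \<open>i, j < N\<close>, outside of which all \<open>g i j\<close>
      vanish.\<close>
    have "exp_left x (mul u v) = (\<Sum>n<2 * N. scale (?c n) (?D n (mul u v)))"
      by (rule exp_left_finite) (simp add: nil')
    also have "\<dots> = (\<Sum>n<2 * N. \<Sum>i\<le>n. g i (n - i))"
    proof (intro sum.cong refl)
      fix n
      have "scale (?c n * of_nat (n choose i)) (mul (?D i u) (?D (n - i) v)) = g i (n - i)"
        if "i \<le> n" for i
        using coeff [of i "n - i" u v] that by (simp add: g_def)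
      then show "scale (?c n) (?D n (mul u v)) = (\<Sum>i\<le>n. g i (n - i))"
        by (simp add: funpow_mul_leibniz scale_sum_right)
    qed
    also have "\<dots> = (\<Sum>(i, j)\<in>{(i, j). i + j < 2 * N}. g i j)"
      by (simp add: sum.triangle_reindex)
    also have "\<dots> = (\<Sum>(i, j)\<in>{..<N} \<times> {..<N}. g i j)"
    proof (rule sum.mono_neutral_right)
      show "finite {(i, j). i + j < 2 * N}"
        by (rule finite_subset [of _ "{..<2 * N} \<times> {..<2 * N}"]) auto
    qed (auto dest: g1)
    also have "\<dots> = mul (exp_left x u) (exp_left x v)"
      by (simp add: exp_left_finite [OF nil] mul_sum_left mul_sum_right sum.cartesian_product
          [symmetric] mul_scale_left mul_scale_right g_def scale_sum_right)
        (subst sum.swap, simp add: mult.commute)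
    finally show ?thesis .
  qed
  ultimately show ?thesis using lin by (simp add: automorphism_def)
qed

lemma fact_coeff:
  assumes "of_nat (fact (i + j)) \<noteq> (0::'f)"
  shows "inverse (of_nat (fact (i + j))) * of_nat (i + j choose i) =
    (inverse (of_nat (fact i)) * inverse (of_nat (fact j)) :: 'f)"
proof -
  have "fact i * fact j * (i + j choose i) = (fact (i + j) :: nat)"
    using binomial_fact_lemma [of i "i + j"] by simp
  then have "of_nat (fact i) * of_nat (fact j) * of_nat (i + j choose i) = (of_nat (fact (i + j)) :: 'f)"
    by (metis of_nat_mult)
  moreover from this have "of_nat (fact i) \<noteq> (0::'f)" "of_nat (fact j) \<noteq> (0::'f)"
    using assms by auto
  ultimately show ?thesis using assms by (simp add: divide_simps mult_ac)
qed

subsection \<open>Nilpotency in characteristic zero\<close>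

definition eval_left :: "'f poly \<Rightarrow> 'v \<Rightarrow> 'v \<Rightarrow> 'v" where
  "eval_left p d v = (\<Sum>i\<le>degree p. scale (coeff p i) ((mul d ^^ i) v))"

lemma eval_left_0 [simp]: "eval_left 0 d v = 0"
  by (simp add: eval_left_def)

lemma eval_left_pCons: "eval_left (pCons a p) d v = scale a v + mul d (eval_left p d v)"
proof (cases "p = 0")
  case False
  then show ?thesis
    by (simp add: eval_left_def sum.atMost_Suc_shift mul_sum_right mul_scale_right del: sum.atMost_Suc)
qed (simp add: eval_left_def)

lemma eval_left_add: "eval_left (p + q) d v = eval_left p d v + eval_left q d v"
  by (induction p q rule: poly_induct2)
    (simp_all add: eval_left_pCons mul_add_right scale_left_distrib algebra_simps)

lemma eval_left_smult: "eval_left (smult a p) d v = scale a (eval_left p d v)"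
  by (induction p) (simp_all add: eval_left_pCons mul_scale_right scale_right_distrib)

lemma eval_left_mult: "eval_left (p * q) d v = eval_left p d (eval_left q d v)"
  by (induction p) (simp_all add: eval_left_pCons eval_left_add eval_left_smult)

lemma eval_left_add_right: "eval_left p d (u + v) = eval_left p d u + eval_left p d v"
  by (induction p) (simp_all add: eval_left_pCons mul_add_right scale_right_distrib algebra_simps)

lemma eval_left_scale_right: "eval_left p d (scale r v) = scale r (eval_left p d v)"
  by (induction p) (simp_all add: eval_left_pCons mul_scale_right scale_right_distrib mult.commute)

lemma eval_left_zero_right [simp]: "eval_left p d 0 = 0"
  by (induction p) (simp_all add: eval_left_pCons)

lemma eval_left_mem:
  "subspace S \<Longrightarrow> (\<And>v. v \<in> S \<Longrightarrow> mul d v \<in> S) \<Longrightarrow> v \<in> S \<Longrightarrow> eval_left p d v \<in> S"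
  by (induction p) (simp_all add: eval_left_pCons subspace_0 subspace_add subspace_scale)

text \<open>Otherwise the values at \<open>v\<close> of the polynomials of degree below
  \<open>n\<close> would form a subspace of dimension at least \<open>n\<close>, for every
  \<open>n\<close>.\<close>

lemma annihilating_poly_vector:
  obtains p where "p \<noteq> 0" "eval_left p d v = 0"
proof (rule ccontr)
  note witness = that
  assume "\<not> thesis"
  then have inj: "p = 0" if "eval_left p d v = 0" for p using witness that by blast
  define S where "S n = {eval_left p d v | p. p = 0 \<or> degree p < n}" for n
  have sub: "subspace (S n)" for n
  proof (unfold subspace_def, intro conjI ballI allI)
    show "0 \<in> S n" by (auto simp: S_def intro!: exI [of _ 0])
  next
    fix a b assume "a \<in> S n" "b \<in> S n"
    then obtain p q where "a = eval_left p d v" "p = 0 \<or> degree p < n"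
      "b = eval_left q d v" "q = 0 \<or> degree q < n" by (auto simp: S_def)
    then show "a + b \<in> S n"
      by (auto simp: S_def eval_left_add [symmetric] intro!: exI [of _ "p + q"] degree_add_less)
  next
    fix r a assume "a \<in> S n"
    then obtain p where "a = eval_left p d v" "p = 0 \<or> degree p < n" by (auto simp: S_def)
    then show "scale r a \<in> S n"
      by (auto simp: S_def eval_left_smult [symmetric] intro!: exI [of _ "smult r p"]
          intro: le_less_trans [OF degree_smult_le])
  qed
  have "n \<le> dim (S n)" for n
  proof (induction n)
    case (Suc n)
    have "eval_left (monom 1 n) d v \<in> S (Suc n)"
      by (auto simp: S_def degree_monom_eq intro!: exI [of _ "monom 1 n"])
    moreover have "eval_left (monom 1 n) d v \<notin> S n"
    proof
      assume "eval_left (monom 1 n) d v \<in> S n"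
      then obtain p where p: "eval_left (monom 1 n) d v = eval_left p d v" "p = 0 \<or> degree p < n"
        by (auto simp: S_def)
      have "eval_left (monom 1 n + smult (- 1) p) d v = 0"
        by (simp only: eval_left_add eval_left_smult p(1)) simp
      then have "monom 1 n = p" using inj by fastforce
      then show False using p(2) by (auto simp: degree_monom_eq)
    qed
    moreover have "S n \<subseteq> S (Suc n)" by (auto simp: S_def)
    ultimately have "S n \<subset> S (Suc n)" by blast
    then show ?case using dim_subspace_less [OF sub sub] Suc.IH by (meson Suc_leI le_less_trans)
  qed simp
  from this [of "Suc (dim UNIV)"] show False using dim_bounded [OF sub] not_less_eq_eq by blast
qed

text \<open>Multiply annihilators of the vectors of a finite spanning set; polynomials in the same
  \<open>d\<close> commute.\<close>

lemma annihilating_poly: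
  obtains p where "p \<noteq> 0" "\<And>v. eval_left p d v = 0"
proof -
  obtain S where S: "finite S" "span S = UNIV" using finite_dim by blast
  from S(1) have "\<exists>p. p \<noteq> 0 \<and> (\<forall>v\<in>S. eval_left p d v = 0)"
  proof induction
    case empty
    show ?case by (rule exI [of _ 1]) simp
  next
    case (insert s S)
    then obtain p where p: "p \<noteq> 0" "\<forall>v\<in>S. eval_left p d v = 0" by blast
    obtain q where q: "q \<noteq> 0" "eval_left q d s = 0" by (rule annihilating_poly_vector)
    have "eval_left (p * q) d v = 0" if "v \<in> insert s S" for v
      using that p q by (metis eval_left_mult eval_left_zero_right insertE mult.commute)
    then show ?case using p q by (intro exI [of _ "p * q"]) auto
  qed
  then obtain p where p: "p \<noteq> 0" "\<forall>v\<in>S. eval_left p d v = 0" by blast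
  have "subspace {v. eval_left p d v = 0}"
    by (auto simp: subspace_def eval_left_add_right eval_left_scale_right)
  then have "span S \<subseteq> {v. eval_left p d v = 0}" using p by (intro span_minimal) auto
  then show thesis using that p S by blast
qed

section \<open>Left ideals and the action on their factors\<close>

definition left_ideal :: "'v set \<Rightarrow> bool" where
  "left_ideal M \<longleftrightarrow> subspace M \<and> (\<forall>x. \<forall>m\<in>M. mul x m \<in> M)"

lemma left_ideal_subspace: "left_ideal M \<Longrightarrow> subspace M"
  and left_ideal_mul: "left_ideal M \<Longrightarrow> m \<in> M \<Longrightarrow> mul x m \<in> M"
  by (auto simp: left_ideal_def)

lemma left_ideal_funpow: "left_ideal M \<Longrightarrow> m \<in> M \<Longrightarrow> (mul x ^^ n) m \<in> M"
  by (rule funpow_mem) (auto simp: left_ideal_def)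

text \<open>Jacobson's lemma on \<open>M / M'\<close>: a commutator \<open>[x, d]\<close> commuting with \<open>d\<close> is nilpotent.
  If \<open>p(d) y\<^sup>k\<close> vanishes, then commuting with \<open>x\<close> shows that \<open>p'(d) y\<^bsup>k + 2\<^esup>\<close> vanishes.\<close>

lemma nilpotent_commutator:
  assumes char: "CHAR('f) = 0"
    and M: "left_ideal M" and M': "left_ideal M'"
    and y: "y = mul x d"
    and yd: "\<And>m. m \<in> M \<Longrightarrow> mul (mul y d) m \<in> M'"
    and xyy: "\<And>m. m \<in> M \<Longrightarrow> mul (mul (mul x y) y) m \<in> M'"
  obtains n where "\<And>m. m \<in> M \<Longrightarrow> (mul y ^^ n) m \<in> M'"
proof -
  note sub = left_ideal_subspace [OF M'] and mem = left_ideal_mul [OF M]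
    and mem' = left_ideal_mul [OF M'] and memp = left_ideal_funpow [OF M]
  have ev: "eval_left p d m \<in> M" if "m \<in> M" for p m
    using that left_ideal_subspace [OF M] mem by (rule_tac eval_left_mem) auto
  have ev': "eval_left p d m \<in> M'" if "m \<in> M'" for p m
    using that left_ideal_subspace [OF M'] mem' by (rule_tac eval_left_mem) auto
  have y_eval: "mul y (eval_left p d m) - eval_left p d (mul y m) \<in> M'" if m: "m \<in> M" for p m
  proof (induction p)
    case (pCons a p)
    have "mul y (eval_left (pCons a p) d m) - eval_left (pCons a p) d (mul y m) =
        mul (mul y d) (eval_left p d m) + mul d (mul y (eval_left p d m) - eval_left p d (mul y m))"
      using leibniz [of y d "eval_left p d m"]
      by (simp add: eval_left_pCons mul_distribs mul_scale_right)
    then show ?case using subspace_add [OF sub yd [OF ev [OF m]] mem' [OF pCons.IH]] by simp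
  qed (simp add: subspace_0 [OF sub])
  \<comment> \<open>Commutation with \<open>x\<close> is a derivation sending \<open>d\<close> to
    \<open>y\<close>. As \<open>y\<close> and \<open>d\<close> commute modulo \<open>M'\<close>, it
    turns \<open>p(d)\<close> into \<open>p'(d) y\<close>.\<close>
  have x_eval: "mul x (eval_left p d m) - eval_left p d (mul x m)
      - eval_left (pderiv p) d (mul y m) \<in> M'" if m: "m \<in> M" for p m
  proof (induction p)
    case (pCons a p)
    let ?e = "eval_left p d m"
    have "mul x (eval_left (pCons a p) d m) - eval_left (pCons a p) d (mul x m)
        - eval_left (pderiv (pCons a p)) d (mul y m) =
      (mul y ?e - eval_left p d (mul y m)) +
      mul d (mul x ?e - eval_left p d (mul x m) - eval_left (pderiv p) d (mul y m))"
      using leibniz [of x d ?e]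
      by (simp add: eval_left_pCons eval_left_add pderiv_pCons mul_distribs mul_scale_right y)
    then show ?case using subspace_add [OF sub y_eval [OF m] mem' [OF pCons.IH]] by simp
  qed (simp add: subspace_0 [OF sub])
  have xy_pow: "mul (mul x y) ((mul y ^^ k) m) - (mul y ^^ k) (mul (mul x y) m) \<in> M'"
    if m: "m \<in> M" for k m
  proof (induction k)
    case (Suc k)
    have "mul (mul x y) ((mul y ^^ Suc k) m) - (mul y ^^ Suc k) (mul (mul x y) m) =
      mul (mul (mul x y) y) ((mul y ^^ k) m) +
      mul y (mul (mul x y) ((mul y ^^ k) m) - (mul y ^^ k) (mul (mul x y) m))"
      using leibniz [of "mul x y" y "(mul y ^^ k) m"] by (simp add: mul_distribs)
    then show ?case using subspace_add [OF sub xyy [OF memp [OF m]] mem' [OF Suc.IH]] by simp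
  qed (simp add: subspace_0 [OF sub])
  \<comment> \<open>Moving \<open>x\<close> to the right past powers of \<open>y\<close> costs at
    most one power: \<open>x y = y x + [x, y]\<close> as maps, and \<open>[x, y]\<close> commutes
    with \<open>y\<close> modulo \<open>M'\<close>.\<close>
  have x_pow: "\<exists>u\<in>M. mul x ((mul y ^^ Suc k) m) - (mul y ^^ k) u \<in> M'" if m: "m \<in> M" for k m
  proof (induction k)
    case 0
    show ?case using mem [OF mem [OF m]] subspace_0 [OF sub]
      by (intro bexI [of _ "mul x (mul y m)"]) auto
  next
    case (Suc k)
    then obtain u where u: "u \<in> M" "mul x ((mul y ^^ Suc k) m) - (mul y ^^ k) u \<in> M'" by blast
    have "mul x ((mul y ^^ Suc (Suc k)) m) - (mul y ^^ Suc k) (mul (mul x y) m + u) =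
      (mul (mul x y) ((mul y ^^ Suc k) m) - (mul y ^^ Suc k) (mul (mul x y) m)) +
      mul y (mul x ((mul y ^^ Suc k) m) - (mul y ^^ k) u)"
      using leibniz [of x y "(mul y ^^ Suc k) m"] by (simp add: mul_distribs funpow_add_mul)
    then show ?case
      using subspace_add [OF sub xy_pow [OF m, of "Suc k"] mem' [OF u(2), of y]]
        subspace_add [OF left_ideal_subspace [OF M] mem [OF m] u(1)]
      by (intro bexI [of _ "mul (mul x y) m + u"]) auto
  qed
  \<comment> \<open>A nonzero member of least degree turns out to be constant, so a power of
    \<open>y\<close> itself maps \<open>M\<close> into \<open>M'\<close>.\<close>
  define P where "P p \<longleftrightarrow> p \<noteq> 0 \<and> (\<exists>k. \<forall>m\<in>M. eval_left p d ((mul y ^^ k) m) \<in> M')" for p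
  obtain p0 where "P p0"
    using annihilating_poly [of d] subspace_0 [OF sub] unfolding P_def by metis
  define p where "p = arg_min degree P"
  have p: "P p" and min: "P q \<Longrightarrow> degree p \<le> degree q" for q
    using arg_min_nat_lemma [of P p0 degree] \<open>P p0\<close> unfolding p_def by auto
  then obtain k where k: "m \<in> M \<Longrightarrow> eval_left p d ((mul y ^^ k) m) \<in> M'" for m
    by (auto simp: P_def)
  have "degree p = 0"
  proof (rule ccontr)
    assume deg: "degree p \<noteq> 0"
    \<comment> \<open>Characteristic 0 enters here: the factor \<open>degree p\<close> of this
      coefficient is nonzero in the field.\<close>
    have "coeff (pderiv p) (degree p - 1) \<noteq> 0"
      using deg p char of_nat_eq_0_iff_char_dvd [where 'a = 'f, of "degree p"]
      by (auto simp: coeff_pderiv P_def simp del: of_nat_Suc)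
    then have "pderiv p \<noteq> 0" by auto
    moreover have "degree (pderiv p) < degree p"
      using deg by (intro degree_lessI) (auto simp: coeff_pderiv coeff_eq_0)
    \<comment> \<open>Both \<open>x p(d)\<close> and \<open>p(d) x\<close> send \<open>?w\<close>
      into \<open>M'\<close>, the latter by \<open>x_pow\<close>. Their difference is
      \<open>p'(d) y ?w\<close> modulo \<open>M'\<close>.\<close>
    moreover have "eval_left (pderiv p) d ((mul y ^^ (k + 2)) m) \<in> M'" if m: "m \<in> M" for m
    proof -
      let ?w = "(mul y ^^ Suc k) m"
      obtain u where u: "u \<in> M" "mul x ?w - (mul y ^^ k) u \<in> M'" using x_pow [OF m] by blast
      have "eval_left p d (mul x ?w - (mul y ^^ k) u) + eval_left p d ((mul y ^^ k) u) \<in> M'"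
        using subspace_add [OF sub ev' [OF u(2)] k [OF u(1)]] .
      then have "eval_left p d (mul x ?w) \<in> M'"
        by (simp flip: eval_left_add_right)
      moreover have "mul x (eval_left p d ?w) \<in> M'"
        using k [OF mem [OF m, of y]] mem' by (simp add: funpow_swap1)
      ultimately have "mul x (eval_left p d ?w) - eval_left p d (mul x ?w) \<in> M'"
        using subspace_diff [OF sub] by blast
      from subspace_diff [OF sub this x_eval [OF memp [OF m, of "Suc k" y], of p]] show ?thesis by simp
    qed
    ultimately show False using min [of "pderiv p"] unfolding P_def by (meson not_less)
  qed
  then obtain c where c: "p = [:c:]" by (rule degree_eq_zeroE)
  then have "c \<noteq> 0" using p by (auto simp: P_def)
  have "(mul y ^^ k) m \<in> M'" if m: "m \<in> M" for m
    using subspace_scale [OF sub k [OF m], of "inverse c"] \<open>c \<noteq> 0\<close> by (simp add: c eval_left_pCons)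
  then show thesis by (rule that)
qed

text \<open>The last iterate of \<open>p\<close> under \<open>y\<close> lying outside
  \<open>M'\<close> is the required \<open>q\<close>.\<close>

lemma nilpotent_kernel:
  assumes "\<And>m. m \<in> P \<Longrightarrow> mul y m \<in> P" "\<And>m. m \<in> P \<Longrightarrow> (mul y ^^ n) m \<in> M'"
    and "p \<in> P" "p \<notin> M'"
  obtains q where "q \<in> P" "q \<notin> M'" "mul y q \<in> M'"
proof -
  define k where "k = (LEAST k. (mul y ^^ k) p \<in> M')"
  have k: "(mul y ^^ k) p \<in> M'"
    unfolding k_def by (rule LeastI [of _ n]) (use assms in auto)
  then obtain l where l: "k = Suc l" using assms(4) by (cases k) auto
  then have "(mul y ^^ l) p \<notin> M'"
    using not_less_Least [of l "\<lambda>k. (mul y ^^ k) p \<in> M'"] by (simp add: k_def)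
  then show thesis using k l funpow_mem [of P y p l] assms by (intro that) auto
qed

text \<open>Left multiplications are derivations, so they preserve every derived term.\<close>

lemma left_ideal_derived_series: "left_ideal (derived_series k)"
proof (induction k)
  case (Suc k)
  have "derived_series (Suc k) \<subseteq> {v. \<forall>x\<in>UNIV. mul x v \<in> derived_series (Suc k)}"
    unfolding derived_series.simps
  proof (rule prod_space_subset)
    fix a b assume "a \<in> derived_series k" "b \<in> derived_series k"
    then show "mul a b \<in> {v. \<forall>x\<in>UNIV. mul x v \<in> prod_space (derived_series k) (derived_series k)}"
      using Suc.IH unfolding left_ideal_def
      by (auto simp: leibniz [of _ a b] intro!: subspace_add [OF subspace_prod_space] mul_mem_prod_space)
  qed (rule subspace_vimage_all [OF subspace_prod_space])
  then show ?case unfolding left_ideal_def using subspace_derived_series by blast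
qed (simp add: left_ideal_def)

text \<open>If the next derived term acts trivially on the irreducible factor \<open>M / M'\<close>,
  the elements of \<open>?D\<close> act by commuting maps. Jacobson's lemma makes first the products
  \<open>mul l d\<close> with \<open>d\<close> in \<open>?D\<close>, and then the generators of
  \<open>?D\<close>, nilpotent; their kernels yield nonzero submodules, which must be the whole
  factor.\<close>

lemma square_acts_trivially:
  assumes char: "CHAR('f) = 0" and solv: solvable
    and M: "left_ideal M" and M': "left_ideal M'" and sub: "M' \<subset> M"
    and irred: "\<And>N. left_ideal N \<Longrightarrow> M' \<subseteq> N \<Longrightarrow> N \<subseteq> M \<Longrightarrow> N = M' \<or> N = M"
    and x: "x \<in> square" and m: "m \<in> M"
  shows "mul x m \<in> M'"
proof -
  note sM = left_ideal_subspace [OF M] and mem = left_ideal_mul [OF M]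
    and sM' = left_ideal_subspace [OF M'] and mem' = left_ideal_mul [OF M']
  define T where "T = {z. \<forall>m\<in>M. mul z m \<in> M'}"
  have sT: "subspace T" unfolding T_def by (rule subspace_vimage_all [OF sM'])
  have Tl: "mul l z \<in> T" "mul z l \<in> T" if "z \<in> T" for l z
    using that mem mem' unfolding T_def by (auto simp: leibniz' intro!: subspace_diff [OF sM'])
  obtain n where n: "derived_series n = {0}" using solv by (auto simp: solvable_def)
  \<comment> \<open>Downward induction along the derived series; starting at \<open>Suc n\<close>
    ensures a start not below 1 even when \<open>n = 0\<close>.\<close>
  have "derived_series 1 \<subseteq> T"
  proof (rule inc_induct [of 1 "Suc n"])
    show "derived_series (Suc n) \<subseteq> T"
      unfolding derived_series.simps n by (rule prod_space_subset [OF sT]) (simp add: subspace_0 [OF sT])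
  next
    fix k assume k: "1 \<le> k" and IH: "derived_series (Suc k) \<subseteq> T"
    let ?D = "derived_series k"
    have DD: "mul a b \<in> T" if "a \<in> ?D" "b \<in> ?D" for a b
      using IH that by (auto simp: mul_mem_prod_space)
    have D: "mul l d \<in> ?D" if "d \<in> ?D" for l d
      using that left_ideal_mul [OF left_ideal_derived_series] by blast
    have nil: "\<exists>n. \<forall>m\<in>M. (mul (mul l d) ^^ n) m \<in> M'" if T: "mul (mul l d) d \<in> T"
      "mul (mul l (mul l d)) (mul l d) \<in> T" for l d
    proof -
      obtain n where "\<And>m. m \<in> M \<Longrightarrow> (mul (mul l d) ^^ n) m \<in> M'"
        by (rule nilpotent_commutator [OF char M M' refl, of l d]) (use T in \<open>auto simp: T_def\<close>)
      then show ?thesis by blast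
    qed
    define E where "E = {m\<in>M. \<forall>l. \<forall>d\<in>?D. mul (mul l d) m \<in> M'}"
    have "left_ideal E"
      unfolding left_ideal_def
    proof (intro conjI allI ballI)
      have "E = M \<inter> {m. \<forall>z\<in>{mul l d | l d. d \<in> ?D}. mul z m \<in> M'}" by (auto simp: E_def)
      then show "subspace E"
        by (simp only: subspace_inter [OF sM subspace_vimage_all(1) [OF sM']])
    next
      fix l m assume m: "m \<in> E"
      have "mul (mul l' d) (mul l m) \<in> M'" if "d \<in> ?D" for l' d
      proof -
        have "mul l (mul (mul l' d) m) \<in> M'" "mul (mul l (mul l' d)) m \<in> M'"
          using m D that mem' by (auto simp: E_def)
        from subspace_diff [OF sM' this] show ?thesis
          by (simp add: leibniz' [of l "mul l' d" m])
      qed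
      then show "mul l m \<in> E" using m mem by (auto simp: E_def)
    qed
    moreover have "E \<noteq> M'"
    proof -
      \<comment> \<open>In a minimal \<open>?D\<close>-stable subspace \<open>P\<close> above
        \<open>M'\<close>, the kernel of a nilpotent \<open>mul l d\<close> modulo \<open>M'\<close>
        is again \<open>?D\<close>-stable and exceeds \<open>M'\<close>, so it is \<open>P\<close>.
        Hence all these products kill \<open>P\<close> at once.\<close>
      define Q where "Q P \<longleftrightarrow> subspace P \<and> M' \<subset> P \<and> P \<subseteq> M \<and> (\<forall>d\<in>?D. \<forall>p\<in>P. mul d p \<in> P)" for P
      have "Q M" using sM sub mem by (simp add: Q_def)
      then obtain P where P: "Q P" and min: "\<And>K. Q K \<Longrightarrow> K \<subseteq> P \<Longrightarrow> K = P"
        using obtain_minimal_subspace [of Q M] Q_def by metis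
      have "mul (mul l d) p \<in> M'" if d: "d \<in> ?D" and p: "p \<in> P" for l d p
      proof -
        let ?y = "mul l d"
        have y: "?y \<in> ?D" using D d .
        define K where "K = P \<inter> {p. mul ?y p \<in> M'}"
        obtain n where n: "\<And>m. m \<in> M \<Longrightarrow> (mul ?y ^^ n) m \<in> M'"
          using nil [OF DD [OF y d] DD [OF D [OF y] y]] by blast
        obtain p0 where p0: "p0 \<in> P" "p0 \<notin> M'" using P unfolding Q_def by blast
        obtain q where "q \<in> P" "q \<notin> M'" "mul ?y q \<in> M'"
        proof (rule nilpotent_kernel [of P ?y n M' p0])
          show "mul ?y m \<in> P" if "m \<in> P" for m using P y that by (simp add: Q_def)
          show "(mul ?y ^^ n) m \<in> M'" if "m \<in> P" for m using P n that by (auto simp: Q_def)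
        qed (use p0 in auto)
        then have "q \<in> K" "q \<notin> M'" by (simp_all add: K_def)
        moreover have "M' \<subseteq> K" using P mem' by (auto simp: Q_def K_def)
        moreover have "mul d' p \<in> K" if "d' \<in> ?D" "p \<in> K" for d' p
        proof -
          have "mul (mul ?y d') p \<in> M'" "mul d' (mul ?y p) \<in> M'"
            using DD [OF y that(1)] that P mem' by (auto simp: T_def K_def Q_def)
          from subspace_add [OF sM' this] show ?thesis
            using that P by (simp add: leibniz [of ?y d' p] K_def Q_def)
        qed
        ultimately have "Q K"
          using P by (auto simp: Q_def K_def intro!: subspace_inter subspace_mul_vimage sM')
        then have "K = P" using min by (auto simp: K_def)
        then show ?thesis using p by (auto simp: K_def)
      qed
      then have "P \<subseteq> E" using P by (auto simp: E_def Q_def)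
      then show ?thesis using P by (auto simp: Q_def)
    qed
    moreover have "M' \<subseteq> E" "E \<subseteq> M" using sub mem' by (auto simp: E_def)
    ultimately have "E = M" using irred by blast
    then have LD: "mul l d \<in> T" if "d \<in> ?D" for l d using that by (auto simp: E_def T_def)
    obtain j where j: "k = Suc j" using k by (cases k) auto
    show "?D \<subseteq> T"
      unfolding j derived_series.simps
    proof (rule prod_space_subset [OF sT])
      fix a b assume ab: "a \<in> derived_series j" "b \<in> derived_series j"
      let ?z = "mul a b"
      have z: "?z \<in> ?D" using ab by (simp add: j mul_mem_prod_space)
      \<comment> \<open>The first stage shows that \<open>mul b ?z\<close> acts trivially. By
        antisymmetry so does \<open>mul ?z b\<close>; thus \<open>?z\<close>, the commutator of
        \<open>a\<close> and \<open>b\<close>, commutes with \<open>b\<close> modulo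
        \<open>M'\<close>.\<close>
      have "mul (mul ?z b) m = - mul (mul b ?z) m" for m
        by (simp only: leibniz' [of ?z b m] leibniz' [of b ?z m] minus_diff_eq)
      then have "mul ?z b \<in> T"
        using LD [OF z, of b] subspace_neg [OF sM'] by (simp add: T_def)
      then obtain n where n: "\<And>m. m \<in> M \<Longrightarrow> (mul ?z ^^ n) m \<in> M'"
        using nil [of a b] LD [OF z] Tl by blast
      define K where "K = M \<inter> {m. mul ?z m \<in> M'}"
      have "mul l m \<in> K" if "m \<in> K" for l m
      proof -
        have "mul l (mul ?z m) \<in> M'" "mul (mul l ?z) m \<in> M'"
          using that LD [OF z, of l] mem' by (auto simp: K_def T_def)
        from subspace_diff [OF sM' this] show ?thesis
          using that mem by (simp add: leibniz' [of l ?z m] K_def)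
      qed
      then have "left_ideal K"
        by (auto simp: left_ideal_def K_def intro!: subspace_inter subspace_mul_vimage sM sM')
      moreover have "M' \<subseteq> K" "K \<subseteq> M" using sub mem' by (auto simp: K_def)
      moreover have "K \<noteq> M'"
      proof -
        obtain m0 where "m0 \<in> M" "m0 \<notin> M'" using sub by auto
        then obtain q where "q \<in> M" "q \<notin> M'" "mul ?z q \<in> M'"
          using nilpotent_kernel [of M ?z n M' m0, OF mem n] by blast
        then show ?thesis unfolding K_def by blast
      qed
      ultimately have "K = M" using irred by blast
      then show "?z \<in> T" by (auto simp: K_def T_def)
    qed
  qed simp
  then show ?thesis using x m by (auto simp: T_def square_def)
qed

text \<open>Induction on the dimension of a left ideal \<open>M\<close>: modulo a maximal smaller
  left ideal \<open>M'\<close> the factor is irreducible, so \<open>x\<close> maps \<open>M\<close>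
  into \<open>M'\<close> and one further power suffices.\<close>

lemma nilpotent_left_mul_square:
  assumes "CHAR('f) = 0" solvable and x: "x \<in> square"
  obtains n where "\<And>v. (mul x ^^ n) v = 0"
proof -
  have "\<exists>n. \<forall>m\<in>M. (mul x ^^ n) m = 0" if "left_ideal M" for M
    using that
  proof (induction M rule: measure_induct_rule [of dim])
    case (less M)
    show ?case
    proof (cases "M = {0}")
      case False
      define Q where "Q N \<longleftrightarrow> left_ideal N \<and> N \<subset> M" for N
      have "Q {0}"
        using False less.prems by (auto simp: Q_def left_ideal_def dest: subspace_0)
      then obtain M' where M': "Q M'" and max: "\<And>N. Q N \<Longrightarrow> M' \<subseteq> N \<Longrightarrow> N = M'"
        using obtain_maximal_subspace [of Q] Q_def left_ideal_subspace by metis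
      then have "dim M' < dim M"
        using dim_subspace_less less.prems by (auto simp: Q_def left_ideal_def)
      then obtain n where n: "\<forall>m\<in>M'. (mul x ^^ n) m = 0"
        using less.IH [of M'] M' unfolding Q_def by blast
      have irred: "N = M' \<or> N = M" if "left_ideal N" "M' \<subseteq> N" "N \<subseteq> M" for N
        using max that by (auto simp: Q_def)
      have "mul x m \<in> M'" if "m \<in> M" for m
        using square_acts_trivially [OF assms(1,2) less.prems _ _ irred x that] M'
        by (simp add: Q_def)
      then show ?thesis using n by (intro exI [of _ "Suc n"]) (simp add: funpow_swap1)
    qed auto
  qed
  from this [of UNIV] show thesis using that by (auto simp: left_ideal_def)
qed

text \<open>In characteristic 0 this rests on Jacobson's lemma. In characteristic \<open>p\<close>
  the bound on the class makes every product of at least \<open>p\<close> factors from the square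
  vanish.\<close>

lemma exp_left_square:
  assumes solv: solvable
    and char: "CHAR('f) \<noteq> 0 \<Longrightarrow> nilpotent square \<and> nilpotency_class square < CHAR('f)"
    and x: "x \<in> square"
  shows "automorphism (exp_left x)" "\<exists>N. \<forall>v. (mul x ^^ N) v = 0"
proof -
  have "\<exists>N. (\<forall>v. (mul x ^^ N) v = 0) \<and> automorphism (exp_left x)"
  proof (cases "CHAR('f) = 0")
    case True
    obtain N where N: "\<And>v. (mul x ^^ N) v = 0"
      using nilpotent_left_mul_square [OF True solv x] by blast
    have "of_nat (fact n) \<noteq> (0::'f)" for n
      using True by (simp add: of_nat_eq_0_iff_char_dvd)
    then have "automorphism (exp_left x)"
      by (intro automorphism_exp_left [OF N]) (simp add: fact_coeff)
    with N show ?thesis by blast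
  next
    case False
    define p where "p = CHAR('f)"
    have p: "prime p" using False prime_CHAR_semidom [where 'a = 'f] by (simp add: p_def)
    have sq: "subalgebra square" by (simp add: subalgebra_def subspace_square mul_mem_square)
    have "lower_central square (nilpotency_class square) = {0}"
      unfolding nilpotency_class_def
      by (rule LeastI_ex) (use char [OF False] in \<open>simp add: nilpotent_def\<close>)
    \<comment> \<open>Class below \<open>p\<close> means that the zero-based series vanishes from
      index \<open>p - 1\<close> on.\<close>
    then have lc: "lower_central square n = {0}" if "p \<le> n + 1" for n
      by (rule lower_central_vanishes) (use char [OF False] that in \<open>auto simp: p_def\<close>)
    \<comment> \<open>The first multiplication only carries \<open>v\<close> into the square; the
      remaining \<open>i\<close> descend the series.\<close>
    have D: "(mul x ^^ Suc i) v \<in> lower_central square i" for i v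
      using funpow_mul_mem_lower_central [OF x, of "mul x v" 0 i]
      by (simp add: mul_mem_square funpow_swap1)
    have N: "(mul x ^^ p) v = 0" for v
    proof -
      obtain q where q: "p = Suc q" using prime_gt_0_nat [OF p] by (cases p) auto
      then show ?thesis using D [of q v] lc [of q] by simp
    qed
    have c0: "of_nat (fact n) = (0::'f) \<longleftrightarrow> p \<le> n" for n
      using prime_dvd_fact_iff [OF p] of_nat_eq_0_iff_char_dvd [where 'a = 'f] by (simp add: p_def)
    have "automorphism (exp_left x)"
    proof (rule automorphism_exp_left [OF N])
      fix i j u v
      let ?t = "mul ((mul x ^^ i) u) ((mul x ^^ j) v)"
      show "scale (inverse (of_nat (fact (i + j))) * of_nat (i + j choose i)) ?t =
        scale (inverse (of_nat (fact i)) * inverse (of_nat (fact j))) ?t"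
      proof (cases "p \<le> i + j")
        case True
        \<comment> \<open>With \<open>inverse 0 = 0\<close> the left coefficient vanishes, whereas
          the right one does so only if \<open>i\<close> or \<open>j\<close> reaches
          \<open>p\<close>.\<close>
        then have c: "of_nat (fact (i + j)) = (0::'f)" using c0 by blast
        show ?thesis
        proof (cases "p \<le> i \<or> p \<le> j")
          case True
          then have "of_nat (fact i) = (0::'f) \<or> of_nat (fact j) = (0::'f)" using c0 by blast
          with c show ?thesis by auto
        next
          case False
          \<comment> \<open>Here the coefficients differ, but the product of \<open>i + j \<ge> p\<close> factors vanishes.\<close>
          then obtain k l where kl: "i = Suc k" "j = Suc l"
            using \<open>p \<le> i + j\<close> by (cases i; cases j) auto
          have "?t \<in> lower_central square (k + l + 1)"
            unfolding kl by (rule mul_lower_central [OF sq D D])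
          moreover have "lower_central square (k + l + 1) = {0}"
            using True kl by (intro lc) auto
          ultimately show ?thesis by simp
        qed
      next
        case False
        then have "of_nat (fact (i + j)) \<noteq> (0::'f)" using c0 by blast
        then show ?thesis by (metis fact_coeff)
      qed
    qed
    with N show ?thesis by blast
  qed
  then show "automorphism (exp_left x)" "\<exists>N. \<forall>v. (mul x ^^ N) v = 0" by blast+
qed

text \<open>Every term of degree at least 2 is a power of \<open>x\<close> applied to
  \<open>mul x (mul x u)\<close>.\<close>

lemma exp_left_congruent:
  assumes "subspace B" "\<And>b. b \<in> B \<Longrightarrow> mul x b \<in> B" "mul x (mul x u) \<in> B"
    and nil: "\<And>v. (mul x ^^ N) v = 0"
  shows "exp_left x u - (u + mul x u) \<in> B"
proof -
  \<comment> \<open>Two extra terms allow splitting off degrees 0 and 1 whatever \<open>N\<close>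
    is.\<close>
  have "(mul x ^^ Suc (Suc N)) v = 0" for v using nil by simp
  from exp_left_finite [OF this, of u]
  have "exp_left x u - (u + mul x u) =
      (\<Sum>r<N. scale (inverse (of_nat (fact (Suc (Suc r))))) ((mul x ^^ Suc (Suc r)) u))"
    by (simp add: sum.lessThan_Suc_shift del: sum.lessThan_Suc funpow.simps fact_Suc) simp
  also have "\<dots> \<in> B"
    using funpow_mem [of B x "mul x (mul x u)"] assms
    by (intro subspace_sum subspace_scale) (simp_all add: funpow_swap1)
  finally show ?thesis .
qed

subsection \<open>Cartan subalgebras\<close>

lemma cartan_subalgebraD:
  assumes "cartan_subalgebra H"
  shows "subspace H" "\<And>a b. a \<in> H \<Longrightarrow> b \<in> H \<Longrightarrow> mul a b \<in> H" "subalgebra H" "nilpotent H"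
    "\<And>x. (\<And>h. h \<in> H \<Longrightarrow> mul x h \<in> H \<and> mul h x \<in> H) \<Longrightarrow> x \<in> H"
  using assms unfolding cartan_subalgebra_def subalgebra_def normalizer_def by blast+

lemma automorphism_id: "automorphism id"
  unfolding automorphism_def Vector_Spaces.linear_iff
  by (simp add: vector_space_axioms)

lemma cartan_subalgebra_image:
  assumes f: "automorphism f" and H: "cartan_subalgebra H"
  shows "cartan_subalgebra (f ` H)"
proof -
  interpret f: Vector_Spaces.linear scale scale f using f by (simp add: automorphism_def)
  have bij: "bij f" and mul: "\<And>x y. f (mul x y) = mul (f x) (f y)"
    using f by (auto simp: automorphism_def)
  have mem: "f x \<in> f ` X \<longleftrightarrow> x \<in> X" for x X
    using bij by (simp add: bij_def inj_image_mem_iff)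
  have prod: "prod_space (f ` X) (f ` Y) = f ` prod_space X Y" for X Y
  proof -
    have "{mul a b | a b. a \<in> f ` X \<and> b \<in> f ` Y} = f ` {mul a b | a b. a \<in> X \<and> b \<in> Y}"
      by (auto simp: mul image_iff) (metis mul)+
    then show ?thesis by (simp add: prod_space_def f.span_image)
  qed
  have lc: "lower_central (f ` H) n = f ` lower_central H n" for n
    by (induction n) (simp_all add: prod)
  have "subspace (f ` H)" by (rule f.subspace_image [OF cartan_subalgebraD(1) [OF H]])
  moreover have "mul a b \<in> f ` H" if "a \<in> f ` H" "b \<in> f ` H" for a b
    using that cartan_subalgebraD(2) [OF H] by (force simp flip: mul)
  moreover have "nilpotent (f ` H)"
  proof -
    obtain n where "lower_central H n = {0}"
      using cartan_subalgebraD(4) [OF H] by (auto simp: nilpotent_def)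
    then have "lower_central (f ` H) n = {0}" by (simp add: lc f.zero)
    then show ?thesis unfolding nilpotent_def ..
  qed
  moreover have "f ` H = normalizer (f ` H)"
  proof (intro equalityI subsetI)
    fix y assume y: "y \<in> normalizer (f ` H)"
    obtain x where x: "y = f x" using bij by (metis bij_pointE)
    have "x \<in> H"
    proof (rule cartan_subalgebraD(5) [OF H])
      fix h assume "h \<in> H"
      then show "mul x h \<in> H \<and> mul h x \<in> H"
        using y unfolding x normalizer_def by (simp add: mem flip: mul)
    qed
    then show "y \<in> f ` H" using x by blast
  next
    fix y assume "y \<in> f ` H"
    then show "y \<in> normalizer (f ` H)" using calculation(2) by (auto simp: normalizer_def)
  qed
  ultimately show ?thesis by (simp add: cartan_subalgebra_def subalgebra_def)
qed

text \<open>Left multiplication by \<open>x c + c x\<close> vanishes, which reduces the two-sided normalizer to the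
  left one.\<close>

lemma cartan_left_normalizer:
  assumes H: "cartan_subalgebra H" and x: "\<And>h. h \<in> H \<Longrightarrow> mul h x \<in> H"
  shows "x \<in> H"
proof -
  note sub = cartan_subalgebraD(1) [OF H] and mem = cartan_subalgebraD(2) [OF H]
  obtain n where n: "lower_central H n = {0}"
    using cartan_subalgebraD(4) [OF H] by (auto simp: nilpotent_def)
  \<comment> \<open>Downward induction along the lower central series:
    \<open>h (x c) = (h x) c + x (h c)\<close> is in \<open>H\<close> by the induction hypothesis,
    so \<open>x c + c x\<close> lies in the two-sided normalizer.\<close>
  have "\<forall>c\<in>lower_central H 0. mul x c \<in> H"
  proof (rule inc_induct [of 0 n])
    show "\<forall>c\<in>lower_central H n. mul x c \<in> H" by (simp add: n subspace_0 [OF sub])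
  next
    fix k assume IH: "\<forall>c\<in>lower_central H (Suc k). mul x c \<in> H"
    show "\<forall>c\<in>lower_central H k. mul x c \<in> H"
    proof
      fix c assume c: "c \<in> lower_central H k"
      then have cH: "c \<in> H" using lower_central_subset cartan_subalgebraD(3) [OF H] by blast
      have "mul x c + mul c x \<in> H"
      proof (rule cartan_subalgebraD(5) [OF H])
        fix h assume h: "h \<in> H"
        have "mul h (mul x c) \<in> H"
          unfolding leibniz [of h x c]
          using subspace_add [OF sub mem [OF x [OF h] cH]] IH h c by (simp add: mul_mem_prod_space)
        then have "mul h (mul x c + mul c x) \<in> H"
          unfolding mul_add_right using subspace_add [OF sub] mem h x cH by blast
        then show "mul (mul x c + mul c x) h \<in> H \<and> mul h (mul x c + mul c x) \<in> H"
          by (simp add: mul_anticomm_zero subspace_0 [OF sub])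
      qed
      from subspace_diff [OF sub this x [OF cH]] show "mul x c \<in> H" by simp
    qed
  qed simp
  with x show ?thesis by (intro cartan_subalgebraD(5) [OF H]) simp
qed

text \<open>On a nontrivial irreducible module of a nilpotent algebra, the last term of the lower central
  series acting nontrivially consists of elements that commute with the action.\<close>

lemma obtain_bijective_element:
  assumes H: "subalgebra H" "nilpotent H"
    and W: "subspace W" "\<And>h w. h \<in> H \<Longrightarrow> w \<in> W \<Longrightarrow> mul h w \<in> W"
    and W': "subspace W'" "\<And>h w. h \<in> H \<Longrightarrow> w \<in> W' \<Longrightarrow> mul h w \<in> W'" "W' \<subseteq> W"
    and irred: "\<And>N. subspace N \<Longrightarrow> (\<And>h w. h \<in> H \<Longrightarrow> w \<in> N \<Longrightarrow> mul h w \<in> N) \<Longrightarrow>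
      W' \<subseteq> N \<Longrightarrow> N \<subseteq> W \<Longrightarrow> N = W' \<or> N = W"
    and nontriv: "h0 \<in> H" "w0 \<in> W" "mul h0 w0 \<notin> W'"
  obtains z where "z \<in> H" "\<And>w. w \<in> W \<Longrightarrow> mul z w \<in> W' \<Longrightarrow> w \<in> W'"
    "\<And>w. w \<in> W \<Longrightarrow> \<exists>v\<in>W. w - mul z v \<in> W'"
proof -
  define K where "K = {h. \<forall>w\<in>W. mul h w \<in> W'}"
  define n where "n = (LEAST n. lower_central H n \<subseteq> K)"
  obtain n0 where "lower_central H n0 = {0}" using H by (auto simp: nilpotent_def)
  then have "lower_central H n0 \<subseteq> K" by (simp add: K_def subspace_0 [OF W'(1)])
  then have n: "lower_central H n \<subseteq> K" unfolding n_def by (rule LeastI)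
  then have "n \<noteq> 0" using nontriv by (cases n) (auto simp: K_def)
  then obtain m where m: "n = Suc m" by (cases n) auto
  then have "\<not> lower_central H m \<subseteq> K"
    using not_less_Least [of m "\<lambda>n. lower_central H n \<subseteq> K"] by (simp add: n_def)
  then obtain z where z: "z \<in> lower_central H m" "z \<notin> K" by blast
  have zH: "z \<in> H" using z lower_central_subset [OF H(1)] by blast
  \<comment> \<open>The product \<open>mul h z\<close> lies in the next term of the series, which
    acts trivially. Hence the kernel and image of \<open>z\<close> modulo \<open>W'\<close> are
    submodules.\<close>
  have hz: "mul (mul h z) w \<in> W'" if "h \<in> H" "w \<in> W" for h w
  proof -
    have "mul h z \<in> K"
      using n mul_mem_prod_space [OF that(1) z(1)] unfolding m lower_central.simps by blast
    then show ?thesis using that(2) by (simp add: K_def)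
  qed
  obtain w1 where w1: "w1 \<in> W" "mul z w1 \<notin> W'" using z by (auto simp: K_def)
  define Ker where "Ker = W \<inter> {w. mul z w \<in> W'}"
  have "Ker = W' \<or> Ker = W"
  proof (rule irred)
    show "subspace Ker" unfolding Ker_def by (intro subspace_inter W subspace_mul_vimage W')
  next
    fix h w assume hw: "h \<in> H" "w \<in> Ker"
    then have "mul h (mul z w) - mul (mul h z) w \<in> W'"
      using hz W' by (intro subspace_diff) (auto simp: Ker_def)
    then show "mul h w \<in> Ker" using hw W by (simp add: Ker_def leibniz')
  qed (use W' zH in \<open>auto simp: Ker_def\<close>)
  then have Ker: "Ker = W'" using w1 by (auto simp: Ker_def)
  interpret z: Vector_Spaces.linear scale scale "mul z" using linear_left_mult [of z] by simp
  define Im where "Im = W \<inter> {u. \<exists>y\<in>mul z ` W. u - y \<in> W'}"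
  have "Im = W' \<or> Im = W"
  proof (rule irred)
    show "subspace Im"
      unfolding Im_def by (intro subspace_inter W subspace_coset_sum z.subspace_image W')
  next
    fix h u assume hu: "h \<in> H" "u \<in> Im"
    then obtain v where v: "v \<in> W" "u - mul z v \<in> W'" by (auto simp: Im_def)
    have "mul h u - mul z (mul h v) = mul h (u - mul z v) + mul (mul h z) v"
      by (simp add: leibniz' mul_distribs)
    also have "\<dots> \<in> W'" using v hz hu W' by (intro subspace_add) auto
    finally show "mul h u \<in> Im" using hu v W by (auto simp: Im_def)
  next
    show "W' \<subseteq> Im" using W'(3) subspace_0 [OF W(1)] by (force simp: Im_def)
  qed (simp add: Im_def)
  moreover have "mul z w1 \<in> Im" using w1(1) W zH by (force simp: Im_def subspace_0 [OF W'(1)])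
  ultimately have Im: "Im = W" using w1 by blast
  show thesis
  proof (rule that [OF zH])
    show "w \<in> W'" if "w \<in> W" "mul z w \<in> W'" for w using Ker that by (auto simp: Ker_def)
    show "\<exists>v\<in>W. w - mul z v \<in> W'" if "w \<in> W" for w using Im that by (auto simp: Im_def)
  qed
qed

lemma funpow_mem_cancel:
  assumes "\<And>w. w \<in> W \<Longrightarrow> mul z w \<in> W" "\<And>w. w \<in> W \<Longrightarrow> mul z w \<in> W' \<Longrightarrow> w \<in> W'"
  shows "t \<in> W \<Longrightarrow> (mul z ^^ n) t \<in> W' \<Longrightarrow> t \<in> W'"
proof (induction n arbitrary: t)
  case (Suc n)
  then have "mul z t \<in> W'"
    using Suc.IH [of "mul z t"] assms(1) by (simp add: funpow_swap1)
  then show ?case using assms(2) Suc.prems(1) by blast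
qed simp

text \<open>Equivalently, \<open>H\<close> fixes no nonzero vector of the quotient by
  \<open>W\<close>. Induction on \<open>dim W\<close>: for a maximal submodule \<open>W'\<close> of
  \<open>W\<close> above \<open>H\<close>, the factor \<open>W / W'\<close> is nontrivial by the
  induction hypothesis. A bijective element \<open>z\<close> then allows correcting \<open>v\<close>
  by an element of \<open>W\<close> so that the hypothesis for \<open>W'\<close> applies.\<close>

lemma left_normalizer_above:
  assumes H: "subalgebra H" "nilpotent H" and norm: "\<And>x. (\<And>h. h \<in> H \<Longrightarrow> mul h x \<in> H) \<Longrightarrow> x \<in> H"
  shows "subspace W \<Longrightarrow> H \<subseteq> W \<Longrightarrow> (\<And>h w. h \<in> H \<Longrightarrow> w \<in> W \<Longrightarrow> mul h w \<in> W) \<Longrightarrow>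
    (\<And>h. h \<in> H \<Longrightarrow> mul h v \<in> W) \<Longrightarrow> v \<in> W"
proof (induction W arbitrary: v rule: measure_induct_rule [of dim])
  case (less W)
  show ?case
  proof (cases "W = H")
    case False
    define Q where "Q N \<longleftrightarrow> subspace N \<and> H \<subseteq> N \<and> N \<subset> W \<and> (\<forall>h\<in>H. \<forall>w\<in>N. mul h w \<in> N)" for N
    have "Q H" using H False less.prems by (auto simp: Q_def subalgebra_def)
    then obtain W' where "Q W'" and max: "\<And>N. Q N \<Longrightarrow> W' \<subseteq> N \<Longrightarrow> N = W'"
      using obtain_maximal_subspace [of Q] Q_def by metis
    then have W': "subspace W'" "H \<subseteq> W'" "W' \<subset> W" "\<And>h w. h \<in> H \<Longrightarrow> w \<in> W' \<Longrightarrow> mul h w \<in> W'"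
      by (auto simp: Q_def)
    have IH: "v \<in> W'" if "\<And>h. h \<in> H \<Longrightarrow> mul h v \<in> W'" for v
      by (rule less.IH [OF dim_subspace_less]) (use W' less.prems that in auto)
    have "\<exists>h0\<in>H. \<exists>w0\<in>W. mul h0 w0 \<notin> W'"
      using IH W' by blast
    then obtain h0 w0 where nontriv: "h0 \<in> H" "w0 \<in> W" "mul h0 w0 \<notin> W'" by blast
    have irred: "N = W' \<or> N = W" if "subspace N" "\<And>h w. h \<in> H \<Longrightarrow> w \<in> N \<Longrightarrow> mul h w \<in> N"
      "W' \<subseteq> N" "N \<subseteq> W" for N
    proof (rule disjCI)
      assume "N \<noteq> W"
      then have "Q N" using that W'(2) unfolding Q_def by blast
      then show "N = W'" using max that(3) by blast
    qed
    obtain z where z: "z \<in> H" and inj: "\<And>w. w \<in> W \<Longrightarrow> mul z w \<in> W' \<Longrightarrow> w \<in> W'"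
      and surj: "\<And>w. w \<in> W \<Longrightarrow> \<exists>v\<in>W. w - mul z v \<in> W'"
      using obtain_bijective_element [OF H less.prems(1,3) W'(1,4) _ irred nontriv] W'(3) by blast
    obtain w where w: "w \<in> W" "mul z v - mul z w \<in> W'" using surj less.prems(4) z by blast
    define v' where "v' = v - w"
    have zv': "mul z v' \<in> W'" using w by (simp add: v'_def mul_diff_right)
    obtain n where n: "\<forall>m\<ge>n. \<forall>x\<in>H. \<forall>y\<in>H. (mul x ^^ m) y = 0"
      using nilpotent_funpow_zero [OF H(2)] by blast
    have "mul h v' \<in> W'" if h: "h \<in> H" for h
    proof -
      \<comment> \<open>Since \<open>mul z v'\<close> is in \<open>W'\<close>, powers of the
        derivation \<open>z\<close> pass to the factor \<open>h\<close> modulo \<open>W'\<close>,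
        where nilpotency of \<open>H\<close> kills them. Injectivity of \<open>z\<close> then puts
        \<open>mul h v'\<close> into \<open>W'\<close>.\<close>
      have "(mul z ^^ j) (mul h v') - mul ((mul z ^^ j) h) v' \<in> W'" for j
      proof (induction j)
        case (Suc j)
        let ?g = "(mul z ^^ j) h"
        have g: "?g \<in> H" using h z H funpow_mem by (auto simp: subalgebra_def)
        have "(mul z ^^ Suc j) (mul h v') - mul ((mul z ^^ Suc j) h) v' =
          mul z ((mul z ^^ j) (mul h v') - mul ?g v') + mul ?g (mul z v')"
          using leibniz [of z ?g v'] by (simp add: mul_distribs)
        also have "\<dots> \<in> W'" using Suc.IH g zv' z W' by (intro subspace_add) auto
        finally show ?case .
      qed (simp add: subspace_0 [OF W'(1)])
      from this [of n] have "(mul z ^^ n) (mul h v') \<in> W'" using n z h by simp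
      moreover have "mul h v' \<in> W"
        unfolding v'_def mul_diff_right using less.prems h w by (intro subspace_diff) auto
      ultimately show ?thesis
        using funpow_mem_cancel [of W z W'] inj less.prems(3) z by blast
    qed
    then have "v' \<in> W" using IH W' by blast
    then show ?thesis using subspace_add [OF less.prems(1) _ w(1), of v'] by (simp add: v'_def)
  qed (use norm less.prems in blast)
qed

text \<open>The preceding lemma applied to the subspace \<open>H + B\<close>.\<close>

lemma cartan_absorbs_trivial:
  assumes H: "cartan_subalgebra H" and B: "subspace B" "\<And>h b. h \<in> H \<Longrightarrow> b \<in> B \<Longrightarrow> mul h b \<in> B"
    and a: "\<And>h. h \<in> H \<Longrightarrow> mul h a \<in> B"
  shows "\<exists>h\<in>H. a - h \<in> B"
proof -
  note sub = cartan_subalgebraD(1) [OF H]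
  have "a \<in> {u. \<exists>h\<in>H. u - h \<in> B}"
  proof (rule left_normalizer_above [of H])
    show "subspace {u. \<exists>h\<in>H. u - h \<in> B}" by (rule subspace_coset_sum [OF sub B(1)])
    show "H \<subseteq> {u. \<exists>h\<in>H. u - h \<in> B}" using subspace_0 [OF B(1)] by force
  next
    fix h u assume h: "h \<in> H" and "u \<in> {u. \<exists>h\<in>H. u - h \<in> B}"
    then obtain k where "k \<in> H" "u - k \<in> B" by blast
    then have "mul h k \<in> H" "mul h u - mul h k \<in> B"
      using h B(2) [of h "u - k"] cartan_subalgebraD(2) [OF H] by (auto simp: mul_diff_right)
    then show "mul h u \<in> {u. \<exists>h\<in>H. u - h \<in> B}" by blast
  next
    fix h assume "h \<in> H"
    then show "mul h a \<in> {u. \<exists>h\<in>H. u - h \<in> B}" using a subspace_0 [OF sub] by force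
  qed (use cartan_subalgebraD(3,4) [OF H] cartan_left_normalizer [OF H] in blast)+
  then show ?thesis by blast
qed

section \<open>Elements of the inner group\<close>

lemma id_mem_inner_group: "id \<in> inner_group A"
  using generate.one [of aut_group "exp_left ` A"] by (simp add: inner_group_def aut_group_def)

lemma exp_left_mem_inner_group: "x \<in> A \<Longrightarrow> exp_left x \<in> inner_group A"
  unfolding inner_group_def by (rule generate.incl) simp

lemma comp_mem_inner_group: "f \<in> inner_group A \<Longrightarrow> g \<in> inner_group A \<Longrightarrow> f \<circ> g \<in> inner_group A"
  using generate.eng [of f aut_group "exp_left ` A" g] by (simp add: inner_group_def aut_group_def)

subsection \<open>Conjugacy modulo a chief factor\<close>

text \<open>Ideals are relative to \<open>U\<close> because the ambient subalgebra shrinks in the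
  final induction.\<close>

definition ideal_in :: "'v set \<Rightarrow> 'v set \<Rightarrow> bool" where
  "ideal_in U A \<longleftrightarrow> subspace A \<and> A \<subseteq> U \<and> (\<forall>u\<in>U. \<forall>a\<in>A. mul u a \<in> A \<and> mul a u \<in> A)"

lemma ideal_inD:
  assumes "ideal_in U A"
  shows "subspace A" "\<And>a. a \<in> A \<Longrightarrow> a \<in> U"
    "\<And>u a. u \<in> U \<Longrightarrow> a \<in> A \<Longrightarrow> mul u a \<in> A" "\<And>u a. u \<in> U \<Longrightarrow> a \<in> A \<Longrightarrow> mul a u \<in> A"
  using assms by (auto simp: ideal_in_def)

lemma ideal_in_span:
  assumes "subspace U" "G \<subseteq> U"
    and "\<And>u g. u \<in> U \<Longrightarrow> g \<in> G \<Longrightarrow> mul u g \<in> span G \<and> mul g u \<in> span G"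
  shows "ideal_in U (span G)"
proof -
  have "span G \<subseteq> U" using assms by (intro span_minimal) auto
  moreover have "span G \<subseteq> {v. \<forall>u\<in>U. mul u v \<in> span G}"
    using assms by (intro span_minimal subspace_vimage_all) auto
  moreover have "span G \<subseteq> {v. \<forall>u\<in>U. mul v u \<in> span G}"
    using assms by (intro span_minimal subspace_vimage_all) auto
  ultimately show ?thesis by (auto simp: ideal_in_def)
qed

text \<open>The products from \<open>A\<close> together with \<open>B\<close> span an ideal of
  \<open>U\<close> between \<open>B\<close> and \<open>A\<close>. If it were \<open>A\<close>, then
  \<open>A\<close> would lie in \<open>derived_series n + B\<close> for every \<open>n\<close>,
  hence in \<open>B\<close> by solvability.\<close>

lemma chief_factor_abelian:
  assumes solv: solvable and U: "subspace U" and A: "ideal_in U A" and B: "ideal_in U B" "B \<subset> A"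
    and max: "\<And>N. ideal_in U N \<Longrightarrow> B \<subseteq> N \<Longrightarrow> N \<subseteq> A \<Longrightarrow> N = B \<or> N = A"
    and ab: "a \<in> A" "b \<in> A"
  shows "mul a b \<in> B"
proof -
  note A' = ideal_inD [OF A] and B' = ideal_inD [OF B(1)]
  define G where "G = B \<union> {mul a b | a b. a \<in> A \<and> b \<in> A}"
  have prod: "mul a b \<in> span G" if "a \<in> A" "b \<in> A" for a b
    using that by (intro span_base) (auto simp: G_def)
  have BG: "b \<in> span G" if "b \<in> B" for b
    using that by (intro span_base) (auto simp: G_def)
  have "G \<subseteq> A" using A' B(2) by (auto simp: G_def)
  have "ideal_in U (span G)"
  proof (rule ideal_in_span [OF U])
    show "G \<subseteq> U" using A' \<open>G \<subseteq> A\<close> by auto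
  next
    fix u g assume u: "u \<in> U" and "g \<in> G"
    then consider "g \<in> B" | a b where "g = mul a b" "a \<in> A" "b \<in> A" by (auto simp: G_def)
    then show "mul u g \<in> span G \<and> mul g u \<in> span G"
    proof cases
      case 1
      then show ?thesis using B' u BG by blast
    next
      case 2
      then have "mul u g \<in> span G"
        using A' u unfolding 2(1) leibniz [of u a b] by (intro span_add prod) auto
      moreover have "mul g u \<in> span G"
        using 2 A' u unfolding 2(1) leibniz' [of a b u] by (intro span_diff prod) auto
      ultimately show ?thesis ..
    qed
  qed
  moreover have "B \<subseteq> span G" using BG by blast
  moreover have "span G \<subseteq> A" using \<open>G \<subseteq> A\<close> A'(1) by (rule span_minimal)
  ultimately consider "span G = B" | "span G = A" using max by blast
  then show ?thesis
  proof cases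
    case 1
    then show ?thesis using prod ab by blast
  next
    case 2
    have A_sub: "A \<subseteq> {x. \<exists>d\<in>derived_series n. x - d \<in> B}" for n
    proof (induction n)
      case 0
      show ?case
      proof (intro subsetI CollectI)
        fix x
        show "\<exists>d\<in>derived_series 0. x - d \<in> B"
          using subspace_0 [OF B'(1)] by (intro bexI [of _ x]) simp_all
      qed
    next
      case (Suc n)
      have "G \<subseteq> {x. \<exists>d\<in>derived_series (Suc n). x - d \<in> B}"
      proof
        fix g assume "g \<in> G"
        then consider "g \<in> B" | a b where "g = mul a b" "a \<in> A" "b \<in> A" by (auto simp: G_def)
        then show "g \<in> {x. \<exists>d\<in>derived_series (Suc n). x - d \<in> B}"
        proof cases
          case 1
          then show ?thesis
            using subspace_0 [OF subspace_derived_series] by (intro CollectI bexI [of _ 0]) (simp_all del: derived_series.simps)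
        next
          case 2
          then obtain d e where de: "d \<in> derived_series n" "a - d \<in> B"
            "e \<in> derived_series n" "b - e \<in> B" using Suc.IH by blast
          have "a - (a - d) \<in> A" by (rule subspace_diff) (use A' 2 de B(2) in auto)
          then have "d \<in> U" using A' by simp
          have "g - mul d e = mul (a - d) b + mul d (b - e)"
            by (simp add: 2(1) mul_distribs)
          also have "\<dots> \<in> B"
            using de 2 A' B' \<open>d \<in> U\<close> by (intro subspace_add) auto
          finally show ?thesis using de by (auto intro: mul_mem_prod_space)
        qed
      qed
      then have "span G \<subseteq> {x. \<exists>d\<in>derived_series (Suc n). x - d \<in> B}"
        by (intro span_minimal subspace_coset_sum subspace_derived_series B')
      then show ?case using 2 by simp
    qed
    obtain n where "derived_series n = {0}" using solv by (auto simp: solvable_def)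
    with A_sub [of n] have "A \<subseteq> B" by auto
    then show ?thesis using B(2) by blast
  qed
qed

text \<open>An irreducible bimodule of a left Leibniz algebra is antisymmetric or has zero right action:
  the elements \<open>a u + u a\<close> generate a subbimodule on which the right action vanishes.\<close>

lemma chief_factor_dichotomy:
  assumes U: "subspace U" "\<And>u v. u \<in> U \<Longrightarrow> v \<in> U \<Longrightarrow> mul u v \<in> U"
    and A: "ideal_in U A" and B: "ideal_in U B" "B \<subset> A"
    and max: "\<And>N. ideal_in U N \<Longrightarrow> B \<subseteq> N \<Longrightarrow> N \<subseteq> A \<Longrightarrow> N = B \<or> N = A"
  shows "(\<forall>a\<in>A. \<forall>u\<in>U. mul a u + mul u a \<in> B) \<or> (\<forall>a\<in>A. \<forall>u\<in>U. mul a u \<in> B)"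
proof -
  note A' = ideal_inD [OF A] and B' = ideal_inD [OF B(1)]
  define G where "G = B \<union> {mul a u + mul u a | a u. a \<in> A \<and> u \<in> U}"
  have sym: "mul a u + mul u a \<in> span G" if "a \<in> A" "u \<in> U" for a u
    using that by (intro span_base) (auto simp: G_def)
  have BG: "b \<in> span G" if "b \<in> B" for b
    using that by (intro span_base) (auto simp: G_def)
  have "G \<subseteq> A" using A' B(2) subspace_add [OF A'(1)] by (auto simp: G_def)
  have "ideal_in U (span G)"
  proof (rule ideal_in_span [OF U(1)])
    show "G \<subseteq> U" using A' \<open>G \<subseteq> A\<close> by auto
  next
    fix v g assume v: "v \<in> U" and "g \<in> G"
    then consider "g \<in> B" | a u where "g = mul a u + mul u a" "a \<in> A" "u \<in> U" by (auto simp: G_def)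
    then show "mul v g \<in> span G \<and> mul g v \<in> span G"
    proof cases
      case 1
      then show ?thesis using B' v BG by blast
    next
      case 2
      \<comment> \<open>The result is a sum of two generators of the same shape, for the pairs
        \<open>mul v a\<close>, \<open>u\<close> and \<open>a\<close>,
        \<open>mul v u\<close>.\<close>
      have "mul v g = (mul (mul v a) u + mul u (mul v a)) + (mul a (mul v u) + mul (mul v u) a)"
        unfolding 2(1) mul_add_right leibniz [of v a u] leibniz [of v u a] by (simp add: algebra_simps)
      then show ?thesis
        using 2 A' U v span_add [OF sym sym] by (simp add: mul_anticomm_zero span_zero)
    qed
  qed
  moreover have "B \<subseteq> span G" using BG by blast
  moreover have "span G \<subseteq> A" using \<open>G \<subseteq> A\<close> A'(1) by (rule span_minimal)
  ultimately consider "span G = B" | "span G = A" using max by blast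
  then show ?thesis
  proof cases
    case 1
    then show ?thesis using sym by blast
  next
    case 2
    have "span G \<subseteq> {a. \<forall>u\<in>U. mul a u \<in> B}"
      by (intro span_minimal subspace_vimage_all B')
        (auto simp: G_def mul_anticomm_zero subspace_0 [OF B'(1)] B')
    then show ?thesis using 2 by blast
  qed
qed

text \<open>Two nilpotent subalgebras whose elements \<open>z\<close> and \<open>z'\<close> act in the same way modulo \<open>B\<close>: a
  difference \<open>h - k\<close> lying in \<open>A\<close> is killed by a power of \<open>z'\<close> modulo \<open>B\<close>.\<close>

lemma nilpotent_diff_mem:
  assumes H: "subalgebra H" "nilpotent H" "z \<in> H" "H \<subseteq> U"
    and K: "nilpotent K" "z' \<in> K"
    and congr: "\<And>u. u \<in> U \<Longrightarrow> mul z u - mul z' u \<in> B"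
    and B: "subspace B" "\<And>b. b \<in> B \<Longrightarrow> mul z' b \<in> B"
    and A: "\<And>a. a \<in> A \<Longrightarrow> mul z' a \<in> A" "\<And>a. a \<in> A \<Longrightarrow> mul z' a \<in> B \<Longrightarrow> a \<in> B"
    and hk: "h \<in> H" "k \<in> K" "h - k \<in> A"
  shows "h - k \<in> B"
proof -
  obtain m where m: "\<forall>n\<ge>m. \<forall>x\<in>H. \<forall>y\<in>H. (mul x ^^ n) y = 0"
    using nilpotent_funpow_zero [OF H(2)] by blast
  obtain m' where m': "\<forall>n\<ge>m'. \<forall>x\<in>K. \<forall>y\<in>K. (mul x ^^ n) y = 0"
    using nilpotent_funpow_zero [OF K(1)] by blast
  define n where "n = max m m'"
  have zero: "(mul z ^^ n) h = 0" "(mul z' ^^ n) k = 0"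
    using m m' H K hk by (auto simp: n_def)
  have "(mul z ^^ j) h - (mul z' ^^ j) h \<in> B" for j
  proof (induction j)
    case (Suc j)
    let ?g = "(mul z ^^ j) h"
    have "?g \<in> H" using funpow_mem [of H z h] H hk by (auto simp: subalgebra_def)
    have "(mul z ^^ Suc j) h - (mul z' ^^ Suc j) h =
        (mul z ?g - mul z' ?g) + mul z' (?g - (mul z' ^^ j) h)"
      by (simp add: mul_diff_right)
    also have "\<dots> \<in> B"
      using congr \<open>?g \<in> H\<close> H(4) B(2) [OF Suc.IH] by (intro subspace_add [OF B(1)]) auto
    finally show ?case .
  qed (simp add: subspace_0 [OF B(1)])
  from subspace_neg [OF B(1) this [of n]] have "(mul z' ^^ n) (h - k) \<in> B"
    by (simp add: zero funpow_diff_mul)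
  then show ?thesis using funpow_mem_cancel [of A z' B] A hk(3) by blast
qed

text \<open>For a trivial action of \<open>H\<close> on \<open>A / B\<close> the identity serves, as
  both subalgebras absorb \<open>A\<close> modulo \<open>B\<close>. Otherwise the dichotomy for the
  right action decides between an exponential and the identity.\<close>

lemma conjugate_modulo:
  assumes H: "cartan_subalgebra H" "H \<subseteq> U" and K: "cartan_subalgebra K" "K \<subseteq> U"
    and U: "subspace U" "\<And>u v. u \<in> U \<Longrightarrow> v \<in> U \<Longrightarrow> mul u v \<in> U"
    and UH: "\<And>u. u \<in> U \<Longrightarrow> \<exists>h\<in>H. u - h \<in> A" and UK: "\<And>u. u \<in> U \<Longrightarrow> \<exists>k\<in>K. u - k \<in> A"
    and A: "ideal_in U A" and B: "ideal_in U B" "B \<subset> A"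
    and max: "\<And>N. ideal_in U N \<Longrightarrow> B \<subseteq> N \<Longrightarrow> N \<subseteq> A \<Longrightarrow> N = B \<or> N = A"
    and AA: "\<And>a b. a \<in> A \<Longrightarrow> b \<in> A \<Longrightarrow> mul a b \<in> B"
    and exp: "\<And>x. x \<in> square \<Longrightarrow> automorphism (exp_left x)"
      "\<And>x. x \<in> square \<Longrightarrow> \<exists>N. \<forall>v. (mul x ^^ N) v = 0"
  shows "\<exists>\<beta>\<in>inner_group square. automorphism \<beta> \<and>
    (\<forall>h\<in>\<beta> ` H. \<exists>k\<in>K. h - k \<in> B) \<and> (\<forall>k\<in>K. \<exists>h\<in>\<beta> ` H. k - h \<in> B)"
proof -
  note H' = cartan_subalgebraD [OF H(1)] and K' = cartan_subalgebraD [OF K(1)]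
    and A' = ideal_inD [OF A] and B' = ideal_inD [OF B(1)]
  have HU: "h \<in> U" if "h \<in> H" for h using that H(2) by blast
  have KU: "k \<in> U" if "k \<in> K" for k using that K(2) by blast
  have BA: "b \<in> A" if "b \<in> B" for b using that B(2) by blast
  show ?thesis
  proof (cases "\<forall>h\<in>H. \<forall>a\<in>A. mul h a \<in> B")
    case True
    \<comment> \<open>\<open>K\<close> lies in \<open>H + A\<close>, and \<open>A\<close> acts
      trivially on \<open>A / B\<close>.\<close>
    have KA: "mul k a \<in> B" if ka: "k \<in> K" "a \<in> A" for k a
    proof -
      obtain h where h: "h \<in> H" "k - h \<in> A" using UH KU ka(1) by blast
      have "mul (k - h) a + mul h a \<in> B"
        using True AA h ka by (intro subspace_add [OF B'(1)]) auto
      then show ?thesis by (simp add: mul_distribs)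
    qed
    have AH: "\<exists>h\<in>H. a - h \<in> B" if "a \<in> A" for a
      using cartan_absorbs_trivial [OF H(1) B'(1), of a] B' HU True that by blast
    have AK: "\<exists>k\<in>K. a - k \<in> B" if "a \<in> A" for a
      using cartan_absorbs_trivial [OF K(1) B'(1), of a] B' KU KA that by blast
    have "\<exists>k\<in>K. h - k \<in> B" if h: "h \<in> H" for h
    proof -
      obtain k where k: "k \<in> K" "h - k \<in> A" using UK HU h by blast
      obtain l where l: "l \<in> K" "h - k - l \<in> B" using AK k by blast
      have "h - (k + l) \<in> B" using l(2) by (simp add: algebra_simps)
      then show ?thesis using subspace_add [OF K'(1) k(1) l(1)] by blast
    qed
    moreover have "\<exists>h\<in>H. k - h \<in> B" if k: "k \<in> K" for k
    proof -
      obtain h where h: "h \<in> H" "k - h \<in> A" using UH KU k by blast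
      obtain l where l: "l \<in> H" "k - h - l \<in> B" using AH h by blast
      have "k - (h + l) \<in> B" using l(2) by (simp add: algebra_simps)
      then show ?thesis using subspace_add [OF H'(1) h(1) l(1)] by blast
    qed
    ultimately show ?thesis
      by (intro bexI [OF _ id_mem_inner_group]) (simp add: automorphism_id)
  next
    case False
    then obtain h0 a0 where nontriv: "h0 \<in> H" "a0 \<in> A" "mul h0 a0 \<notin> B" by blast
    have dichotomy: "(\<forall>a\<in>A. \<forall>u\<in>U. mul a u + mul u a \<in> B) \<or> (\<forall>a\<in>A. \<forall>u\<in>U. mul a u \<in> B)"
      using chief_factor_dichotomy [OF U A B max] .
    \<comment> \<open>Submodules for \<open>H\<close> are already ideals of \<open>U\<close>: the
      left action of \<open>U = H + A\<close> on \<open>A / B\<close> reduces to that of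
      \<open>H\<close>, and the dichotomy controls the right action.\<close>
    have irred: "N = B \<or> N = A" if N: "subspace N" "\<And>h w. h \<in> H \<Longrightarrow> w \<in> N \<Longrightarrow> mul h w \<in> N"
      "B \<subseteq> N" "N \<subseteq> A" for N
    proof (rule max)
      have "mul u n \<in> N \<and> mul n u \<in> N" if u: "u \<in> U" and n: "n \<in> N" for u n
      proof -
        obtain h where h: "h \<in> H" "u - h \<in> A" using UH u by blast
        have "mul (u - h) n \<in> N" using AA h(2) n N(3,4) by blast
        then have "mul h n + mul (u - h) n \<in> N"
          using N(2) h(1) n by (intro subspace_add [OF N(1)])
        then have un: "mul u n \<in> N" by (simp add: mul_distribs)
        have "mul n u \<in> N"
          using dichotomy
        proof
          assume "\<forall>a\<in>A. \<forall>u\<in>U. mul a u + mul u a \<in> B"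
          then have "mul n u + mul u n \<in> N" using N u n by blast
          from subspace_diff [OF N(1) this un] show ?thesis by simp
        qed (use N u n in blast)
        with un show ?thesis ..
      qed
      then show "ideal_in U N" using N A' by (auto simp: ideal_in_def)
    qed (use N in auto)
    obtain z where z: "z \<in> H" and inj: "\<And>a. a \<in> A \<Longrightarrow> mul z a \<in> B \<Longrightarrow> a \<in> B"
      and surj: "\<And>a. a \<in> A \<Longrightarrow> \<exists>c\<in>A. a - mul z c \<in> B"
      using obtain_bijective_element [OF H'(3,4) A'(1) A'(3) [OF HU] B'(1) B'(3) [OF HU]
          psubset_imp_subset [OF B(2)] irred nontriv] by blast
    obtain z' where z': "z' \<in> K" "z - z' \<in> A" using UK HU z by blast
    have inj': "a \<in> B" if a: "a \<in> A" "mul z' a \<in> B" for a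
    proof -
      have "mul z' a + mul (z - z') a \<in> B"
        using a z' AA by (intro subspace_add [OF B'(1)]) auto
      then show ?thesis using inj a by (simp add: mul_distribs)
    qed
    \<comment> \<open>It remains to find \<open>\<beta>\<close> that is the identity on
      \<open>U\<close> modulo \<open>A\<close> and for which \<open>\<beta> z\<close> and
      \<open>z'\<close> act alike modulo \<open>B\<close>.\<close>
    have main: ?thesis
      if \<beta>: "\<beta> \<in> inner_group square" "automorphism \<beta>" "\<And>u. u \<in> U \<Longrightarrow> \<beta> u - u \<in> A"
        "\<And>u. u \<in> U \<Longrightarrow> mul (\<beta> z) u - mul z' u \<in> B" for \<beta>
    proof -
      note \<beta>H = cartan_subalgebra_image [OF \<beta>(2) H(1)]
      have \<beta>U: "\<beta> ` H \<subseteq> U"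
        using \<beta>(3) HU A'(2) mem_of_diff_mem [OF U(1)] by blast
      have diff: "h - k \<in> B" if "h \<in> \<beta> ` H" "k \<in> K" "h - k \<in> A" for h k
        by (rule nilpotent_diff_mem [OF cartan_subalgebraD(3,4) [OF \<beta>H] imageI [OF z] \<beta>U
              K'(4) z'(1) \<beta>(4) B'(1) B'(3) [OF KU [OF z'(1)]] A'(3) [OF KU [OF z'(1)]] inj' that])
      have "\<exists>k\<in>K. h - k \<in> B" if h: "h \<in> \<beta> ` H" for h
        using UK [of h] \<beta>U h diff by blast
      moreover have "\<exists>h\<in>\<beta> ` H. k - h \<in> B" if k: "k \<in> K" for k
      proof -
        obtain h where h: "h \<in> H" "k - h \<in> A" using UH KU k by blast
        have "\<beta> h - k \<in> A"
          using subspace_diff [OF A'(1) \<beta>(3) [OF HU [OF h(1)]] h(2)] by simp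
        then have "\<beta> h - k \<in> B" using diff k h(1) by blast
        then show ?thesis using subspace_diff_sym [OF B'(1)] h(1) by blast
      qed
      ultimately show ?thesis using \<beta>(1,2) by blast
    qed
    from dichotomy show ?thesis
    proof
      assume sym: "\<forall>a\<in>A. \<forall>u\<in>U. mul a u + mul u a \<in> B"
      \<comment> \<open>The natural exponent is \<open>b\<close>, but it need not lie in the square;
        solving once more replaces it by the product \<open>mul z c\<close>, congruent to
        \<open>b\<close>. Modulo \<open>B\<close>, antisymmetry gives
        \<open>exp_left ?x z = z - mul z b = z'\<close>.\<close>
      obtain b where b: "b \<in> A" "z - z' - mul z b \<in> B" using surj z' by blast
      obtain c where c: "c \<in> A" "b - mul z c \<in> B" using surj b by blast
      let ?x = "mul z c"
      have x: "?x \<in> A" "?x \<in> square" using A' HU z c by (auto simp: mul_mem_square)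
      obtain N where N: "\<And>v. (mul ?x ^^ N) v = 0" using exp(2) [OF x(2)] by blast
      have congr: "exp_left ?x u - (u + mul ?x u) \<in> B" if "u \<in> U" for u
        by (rule exp_left_congruent [OF B'(1) _ _ N]) (use x A' B' AA that in auto)
      have "exp_left ?x z - z' = (exp_left ?x z - (z + mul ?x z)) + (mul ?x z + mul z ?x)
          + (z - z' - mul z b) + mul z (b - ?x)"
        by (simp add: mul_distribs)
      also have "\<dots> \<in> B"
      proof (rule subspace_add [OF B'(1) subspace_add [OF B'(1) subspace_add [OF B'(1)] b(2)]])
        show "exp_left ?x z - (z + mul ?x z) \<in> B" using congr HU z by blast
        show "mul ?x z + mul z ?x \<in> B" using sym x(1) HU z by blast
        show "mul z (b - ?x) \<in> B" using B'(3) HU z c(2) by blast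
      qed
      finally have zz': "exp_left ?x z - z' \<in> B" .
      show ?thesis
      proof (rule main [of "exp_left ?x"])
        fix u assume u: "u \<in> U"
        have "exp_left ?x u - u = (exp_left ?x u - (u + mul ?x u)) + mul ?x u" by simp
        also have "\<dots> \<in> A" using congr u x A' BA by (intro subspace_add [OF A'(1)]) auto
        finally show "exp_left ?x u - u \<in> A" .
        show "mul (exp_left ?x z) u - mul z' u \<in> B"
          using B'(4) [OF u zz'] by (simp add: mul_diff_left)
      qed (use x exp exp_left_mem_inner_group in auto)
    next
      assume "\<forall>a\<in>A. \<forall>u\<in>U. mul a u \<in> B"
      \<comment> \<open>Here \<open>z - z'\<close> lies in \<open>A\<close> and so acts trivially on
        \<open>U\<close> from the left modulo \<open>B\<close>.\<close>
      then have "mul z u - mul z' u \<in> B" if "u \<in> U" for u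
        using that z' by (simp flip: mul_diff_left)
      then show ?thesis
        by (intro main [OF id_mem_inner_group automorphism_id])
          (simp_all add: subspace_0 [OF A'(1)])
    qed
  qed
qed

text \<open>Induction on \<open>dim A\<close>, passing from \<open>A\<close> to \<open>B\<close> and
  from \<open>H\<close> to its conjugate. When \<open>A\<close> is zero, both Cartan subalgebras
  equal \<open>U\<close>.\<close>

lemma conjugate_over_ideal:
  assumes solv: solvable and K: "cartan_subalgebra K"
    and exp: "\<And>x. x \<in> square \<Longrightarrow> automorphism (exp_left x)"
      "\<And>x. x \<in> square \<Longrightarrow> \<exists>N. \<forall>v. (mul x ^^ N) v = 0"
  shows "cartan_subalgebra H \<Longrightarrow> H \<subseteq> U \<Longrightarrow> K \<subseteq> U \<Longrightarrow> subspace U \<Longrightarrow>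
    (\<And>u v. u \<in> U \<Longrightarrow> v \<in> U \<Longrightarrow> mul u v \<in> U) \<Longrightarrow> ideal_in U A \<Longrightarrow>
    (\<And>u. u \<in> U \<Longrightarrow> \<exists>h\<in>H. u - h \<in> A) \<Longrightarrow> (\<And>u. u \<in> U \<Longrightarrow> \<exists>k\<in>K. u - k \<in> A) \<Longrightarrow>
    \<exists>\<beta>\<in>inner_group square. \<beta> ` H = K"
proof (induction A arbitrary: H U rule: measure_induct_rule [of dim])
  case (less A)
  note H = less.prems(1,2) and KU = less.prems(3) and U = less.prems(4,5) and A = less.prems(6)
    and UH = less.prems(7) and UK = less.prems(8)
  show ?case
  proof (cases "A = {0}")
    case True
    then have "H = K" using UH UK H KU by fastforce
    then show ?thesis by (intro bexI [OF _ id_mem_inner_group]) simp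
  next
    case False
    note A' = ideal_inD [OF A]
    define Q where "Q N \<longleftrightarrow> ideal_in U N \<and> N \<subset> A" for N
    have "Q {0}"
      using False A' subspace_0 [OF A'(1)] by (auto simp: Q_def ideal_in_def)
    then obtain B where "Q B" and max: "\<And>N. Q N \<Longrightarrow> B \<subseteq> N \<Longrightarrow> N = B"
      using obtain_maximal_subspace [of Q] Q_def ideal_inD(1) by metis
    then have B: "ideal_in U B" "B \<subset> A" by (auto simp: Q_def)
    note B' = ideal_inD [OF B(1)]
    have max': "N = B \<or> N = A" if "ideal_in U N" "B \<subseteq> N" "N \<subseteq> A" for N
      using max that by (auto simp: Q_def)
    have AA: "mul a b \<in> B" if "a \<in> A" "b \<in> A" for a b
      using chief_factor_abelian [OF solv U(1) A B max' that] .
    have "\<exists>\<beta>\<in>inner_group square. automorphism \<beta> \<and>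
        (\<forall>h\<in>\<beta> ` H. \<exists>k\<in>K. h - k \<in> B) \<and> (\<forall>k\<in>K. \<exists>h\<in>\<beta> ` H. k - h \<in> B)"
      by (rule conjugate_modulo [OF H K KU U UH UK A B max' AA exp])
    then obtain \<beta> where \<beta>: "\<beta> \<in> inner_group square" "automorphism \<beta>"
      "\<forall>h\<in>\<beta> ` H. \<exists>k\<in>K. h - k \<in> B" "\<forall>k\<in>K. \<exists>h\<in>\<beta> ` H. k - h \<in> B"
      by (elim bexE conjE)
    \<comment> \<open>The new ambient subalgebra is \<open>K + B\<close>, which contains the
      conjugate of \<open>H\<close> and equals its sum with \<open>B\<close>.\<close>
    define V where "V = {u. \<exists>k\<in>K. u - k \<in> B}"
    note K' = cartan_subalgebraD [OF K]
    have VU: "v \<in> U" if v: "v \<in> V" for v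
    proof -
      obtain k where "k \<in> K" "v - k \<in> B" using v by (auto simp: V_def)
      then show ?thesis using mem_of_diff_mem [OF U(1) B'(2)] KU by blast
    qed
    have "\<exists>\<gamma>\<in>inner_group square. \<gamma> ` \<beta> ` H = K"
    proof (rule less.IH [of B "\<beta> ` H" V])
      show "dim B < dim A" using dim_subspace_less A' B' B(2) by blast
      show "cartan_subalgebra (\<beta> ` H)" using cartan_subalgebra_image [OF \<beta>(2) H(1)] .
      show "\<beta> ` H \<subseteq> V" using \<beta>(3) unfolding V_def by blast
      show "K \<subseteq> V" using subspace_0 [OF B'(1)] by (force simp: V_def)
      show "subspace V" unfolding V_def by (rule subspace_coset_sum [OF K'(1) B'(1)])
      show "mul u v \<in> V" if uv: "u \<in> V" "v \<in> V" for u v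
      proof -
        obtain k l where kl: "k \<in> K" "u - k \<in> B" "l \<in> K" "v - l \<in> B"
          using uv by (auto simp: V_def)
        have "mul u v - mul k l = mul (u - k) v + mul k (v - l)" by (simp add: mul_distribs)
        also have "\<dots> \<in> B"
          using kl B' VU uv KU by (intro subspace_add [OF B'(1)]) auto
        finally show ?thesis using K'(2) kl by (auto simp: V_def)
      qed
      show "ideal_in V B"
        unfolding ideal_in_def
      proof (intro conjI ballI)
        show "B \<subseteq> V" using subspace_0 [OF K'(1)] by (force simp: V_def)
      qed (use B' VU in auto)
      show "\<exists>k\<in>K. u - k \<in> B" if "u \<in> V" for u using that by (simp add: V_def)
      show "\<exists>h\<in>\<beta> ` H. u - h \<in> B" if "u \<in> V" for u
      proof -
        obtain k where k: "k \<in> K" "u - k \<in> B" using \<open>u \<in> V\<close> by (auto simp: V_def)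
        obtain h where h: "h \<in> \<beta> ` H" "k - h \<in> B" using \<beta>(4) k(1) by (elim ballE bexE) auto
        then show ?thesis using subspace_diff_trans [OF B'(1) k(2) h(2)] by blast
      qed
    qed
    then obtain \<gamma> where "\<gamma> \<in> inner_group square" "\<gamma> ` \<beta> ` H = K" by blast
    then show ?thesis
      by (intro bexI [of _ "\<gamma> \<circ> \<beta>"] comp_mem_inner_group \<beta>(1)) (simp_all add: image_comp)
  qed
qed

theorem cartan_subalgebras_conjugate:
  assumes solv: solvable
    and char: "CHAR('f) \<noteq> 0 \<Longrightarrow> nilpotent square \<and> nilpotency_class square < CHAR('f)"
    and H: "cartan_subalgebra H" and K: "cartan_subalgebra K"
  shows "\<exists>\<beta>\<in>inner_group square. \<beta> ` H = K"
proof (rule conjugate_over_ideal [OF solv K exp_left_square [OF solv char] H, where A = UNIV])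
  show "ideal_in UNIV UNIV" by (simp add: ideal_in_def)
  show "\<exists>h\<in>H. u - h \<in> UNIV" "\<exists>k\<in>K. u - k \<in> UNIV" for u
    using subspace_0 cartan_subalgebraD(1) H K by blast+
qed simp_all

end

theorem theorem5:
  fixes scale :: "'f::field \<Rightarrow> 'v::ab_group_add \<Rightarrow> 'v"
    and mul :: "'v \<Rightarrow> 'v \<Rightarrow> 'v"
    and H1 H2 :: "'v set"
  assumes "leibniz_algebra scale mul"
    and "leibniz_algebra.solvable scale mul"
    and "CHAR('f) \<noteq> 0 \<Longrightarrow>
      leibniz_algebra.nilpotent scale mul (leibniz_algebra.square scale mul) \<and>
      leibniz_algebra.nilpotency_class scale mul (leibniz_algebra.square scale mul) < CHAR('f)"
    and "leibniz_algebra.cartan_subalgebra scale mul H1"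
    and "leibniz_algebra.cartan_subalgebra scale mul H2"
  shows "\<exists>\<beta> \<in> leibniz_algebra.inner_group scale mul (leibniz_algebra.square scale mul). \<beta> ` H1 = H2"
  by (rule leibniz_algebra.cartan_subalgebras_conjugate [OF assms])

end
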